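(* For every $d\ge3$ there exists $p_0<1$ such that for every $p\in(p_0,1)$, in oriented percolation with parameter $p$ on $\mathbf{Z}^d$, almost surely there is a vertex $v\in\mathbf{Z}^d$ whose oriented open cluster $\mathcal{C}(v)$ is transient for simple random walk.
   Context: $\mathbf{Z}^d$ is regarded as a directed graph with a directed edge from $x$ to $x+e_i$ for every $x\in\mathbf{Z}^d$ and each of the $d$ standard basis vectors $e_i$. Oriented percolation with parameter $p\in(0,1)$: each directed edge is independently declared open with probability $p$ and closed with probability $1-p$. The oriented open cluster $\mathcal{C}(v)$ of a vertex $v$ is the union of all directed open paths emanating from $v$. A subgraph is called transient if, when the orientations of its edges are ignored, it is connected and simple random walk on it is a transient Markov chain. *)

theory Defs
  imports "HOL-Probability.Probability" "Graph_Theory.Digraph_Component"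
begin

definition Zd_digraph :: "(int ^ 'd) pair_pre_digraph" where
  "Zd_digraph = \<lparr> pverts = UNIV, parcs = {(x, x + axis i 1) | x i. True} \<rparr>"

text \<open>A configuration maps each edge of \<open>Zd_digraph\<close> to \<^const>\<open>True\<close> (open) or
  \<^const>\<open>False\<close> (closed); the edges are independent under the product measure.\<close>

definition oriented_percolation :: "real \<Rightarrow> ((int ^ 'd) \<times> (int ^ 'd) \<Rightarrow> bool) measure" where
  "oriented_percolation p = (\<Pi>\<^sub>M e\<in>parcs Zd_digraph. measure_pmf (bernoulli_pmf p))"

definition open_digraph :: "((int ^ 'd) \<times> (int ^ 'd) \<Rightarrow> bool) \<Rightarrow> (int ^ 'd) pair_pre_digraph" where
  "open_digraph \<omega> = \<lparr> pverts = UNIV, parcs = {e \<in> parcs Zd_digraph. \<omega> e} \<rparr>"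

text \<open>The union, as graphs, of all directed open paths starting at \<open>v\<close> (a path is given by its list
  of arcs). The empty path is included, so \<open>v\<close> itself always belongs to the cluster.\<close>

definition oriented_cluster ::
  "((int ^ 'd) \<times> (int ^ 'd) \<Rightarrow> bool) \<Rightarrow> int ^ 'd \<Rightarrow> (int ^ 'd) pair_pre_digraph" where
  "oriented_cluster \<omega> v = \<lparr>
     pverts = (\<Union>es \<in> {es. \<exists>w. pre_digraph.apath (open_digraph \<omega>) v es w}.
                 set (pre_digraph.awalk_verts (open_digraph \<omega>) v es)),
     parcs = (\<Union>es \<in> {es. \<exists>w. pre_digraph.apath (open_digraph \<omega>) v es w}. set es) \<rparr>"


text \<open>The law, on trajectories \<^typ>\<open>nat \<Rightarrow> 'a\<close>, of the Markov chain with transition probabilities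
  \<open>K\<close> started at \<open>x\<close>.\<close>

definition markov_step :: "('a \<Rightarrow> 'a pmf) \<Rightarrow> 'a \<Rightarrow> nat \<Rightarrow> (nat \<Rightarrow> 'a) \<Rightarrow> 'a measure" where
  "markov_step K x n s = measure_pmf (case n of 0 \<Rightarrow> return_pmf x | Suc m \<Rightarrow> K (s m))"

definition markov_chain_law :: "('a \<Rightarrow> 'a pmf) \<Rightarrow> 'a \<Rightarrow> (nat \<Rightarrow> 'a) measure" where
  "markov_chain_law K x =
     projective_family.lim UNIV
       (Ionescu_Tulcea.CI (markov_step K x) (\<lambda>_. count_space UNIV)) (\<lambda>_. count_space UNIV)"

definition transient_chain :: "'a set \<Rightarrow> ('a \<Rightarrow> 'a pmf) \<Rightarrow> bool" where
  "transient_chain S K \<longleftrightarrow>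
     (\<forall>x\<in>S. measure (markov_chain_law K x) {s. \<exists>n>0. s n = x} < 1)"

text \<open>Simple random walk on a locally finite graph without parallel edges, ignoring orientations.
  At a vertex without neighbours the walk stays put (so the one-vertex graph is not transient).\<close>

definition simple_random_walk :: "('a, 'b) pre_digraph \<Rightarrow> 'a \<Rightarrow> 'a pmf" where
  "simple_random_walk G x =
     (let N = {y. x \<rightarrow>\<^bsub>mk_symmetric G\<^esub> y} in if N = {} then return_pmf x else pmf_of_set N)"

definition transient_graph :: "('a, 'b) pre_digraph \<Rightarrow> bool" where
  "transient_graph G \<longleftrightarrow>
     Digraph_Component.connected G \<and> transient_chain (verts G) (simple_random_walk G)"


text \<open>\<^const>\<open>markov_chain_law\<close> is indeed the law of the Markov chain.\<close>

lemma Ionescu_Tulcea_markov_step: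
  "Ionescu_Tulcea (markov_step K x) (\<lambda>_. count_space UNIV)"
proof (rule Ionescu_Tulcea.intro)
  fix i
  show "markov_step K x i \<in> Pi\<^sub>M {0..<i} (\<lambda>_. count_space UNIV) \<rightarrow>\<^sub>M subprob_algebra (count_space UNIV)"
  proof (cases i)
    case 0
    then show ?thesis
      by (simp add: markov_step_def[abs_def] measure_pmf_in_subprob_algebra)
  next
    case (Suc m)
    have "(\<lambda>s. s m) \<in> Pi\<^sub>M {0..<i} (\<lambda>_. count_space UNIV) \<rightarrow>\<^sub>M count_space UNIV"
      by (rule measurable_component_singleton) (simp add: Suc)
    moreover have "(\<lambda>a. measure_pmf (K a)) \<in> count_space UNIV \<rightarrow>\<^sub>M subprob_algebra (count_space UNIV)"
      by (simp add: measure_pmf_in_subprob_algebra)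
    ultimately show ?thesis
      unfolding Suc markov_step_def[abs_def] by (auto intro: measurable_compose)
  qed
next
  fix i s show "prob_space (markov_step K x i s)"
    unfolding markov_step_def by (rule prob_space_measure_pmf)
qed

lemma space_markov_chain_law [simp]: "space (markov_chain_law K x) = UNIV"
  and sets_markov_chain_law [measurable_cong]:
    "sets (markov_chain_law K x) = sets (\<Pi>\<^sub>M n\<in>UNIV. count_space UNIV)"
  and prob_space_markov_chain_law: "prob_space (markov_chain_law K x)"
proof -
  interpret Ionescu_Tulcea "markov_step K x" "\<lambda>_. count_space UNIV"
    by (rule Ionescu_Tulcea_markov_step)
  show "space (markov_chain_law K x) = UNIV"
    by (simp add: markov_chain_law_def PF.space_lim space_PiM PiE_def)
  show "sets (markov_chain_law K x) = sets (\<Pi>\<^sub>M n\<in>UNIV. count_space UNIV)"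
    by (simp add: markov_chain_law_def)
  have "emeasure PF.lim (PF.emb UNIV {} {\<lambda>_. undefined}) = emeasure (CI {}) {\<lambda>_. undefined}"
    by (rule lim) (auto simp: PiM_empty)
  moreover have "emeasure (CI {}) {\<lambda>_. undefined} = 1"
    using prob_space.emeasure_space_1[OF PF.prob_space_P, of "{}"] by (simp add: PF.space_P space_PiM)
  moreover have "PF.emb UNIV {} {\<lambda>_. undefined} = (UNIV :: (nat \<Rightarrow> 'a) set)"
    by (auto simp: prod_emb_def space_PiM restrict_def)
  ultimately show "prob_space (markov_chain_law K x)"
    by (intro prob_spaceI) (simp add: markov_chain_law_def PF.space_lim space_PiM PiE_def)
qed

lemma emeasure_markov_chain_law_cylinder:
  "emeasure (markov_chain_law K x) {s. \<forall>i\<le>n. s i = t i} =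
     ennreal ((if t 0 = x then 1 else 0) * (\<Prod>i<n. pmf (K (t i)) (t (Suc i))))"
proof -
  interpret Ionescu_Tulcea "markov_step K x" "\<lambda>_. count_space UNIV"
    by (rule Ionescu_Tulcea_markov_step)
  define u where "u n = restrict t {0..<n}" for n
  let ?f = "\<lambda>n. (\<Prod>i<n. pmf (case i of 0 \<Rightarrow> return_pmf x | Suc m \<Rightarrow> K (t m)) (t i))"
  have sing: "{u n} \<in> sets (PiM {0..<n} (\<lambda>_. count_space UNIV))" for n
  proof -
    have "{u n} = (\<Pi>\<^sub>E i\<in>{0..<n}. {u n i})" by (rule PiE_singleton[symmetric]) (simp add: u_def)
    also have "\<dots> \<in> sets (PiM {0..<n} (\<lambda>_. count_space UNIV))"
      by (rule sets_PiM_I_finite) simp_all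
    finally show ?thesis .
  qed
  have step: "emeasure (C 0 n (\<lambda>_. undefined)) {u n} = ennreal (?f n)" for n
  proof (induction n)
    case 0
    then show ?case using sing[of 0] by (simp add: u_def restrict_def)
  next
    case (Suc n)
    let ?M = "PiM {0..<n} (\<lambda>_. count_space UNIV)"
    let ?p = "pmf (case n of 0 \<Rightarrow> return_pmf x | Suc m \<Rightarrow> K (t m)) (t n)"
    have un: "(\<lambda>_. undefined) \<in> space (PiM {0..<0::nat} (\<lambda>_. count_space (UNIV::'a set)))"
      by (simp add: space_PiM)
    have e: "eP n s {u (Suc n)} = ennreal ?p * indicator {u n} s" if s: "s \<in> space ?M" for s
    proof -
      have "s(n := y) = u (Suc n) \<longleftrightarrow> s = u n \<and> y = t n" for y
      proof
        assume A: "s(n := y) = u (Suc n)"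
        have "s i = u n i" for i
          using fun_cong[OF A, of i] s by (cases "i < n") (auto simp: u_def space_PiM PiE_def extensional_def)
        moreover have "y = t n" using fun_cong[OF A, of n] by (simp add: u_def)
        ultimately show "s = u n \<and> y = t n" by auto
      qed (auto simp: u_def fun_eq_iff)
      then have "(\<lambda>y. s(n := y)) -` {u (Suc n)} = (if s = u n then {t n} else {})"
        by (auto simp only: vimage_def singleton_iff split: if_splits)
      moreover have "markov_step K x n (u n) = measure_pmf (case n of 0 \<Rightarrow> return_pmf x | Suc m \<Rightarrow> K (t m))"
        by (cases n) (simp_all add: markov_step_def u_def)
      ultimately show ?thesis
        using emeasure_eP[OF s sing[of "Suc n"]] by (simp add: emeasure_pmf_single)
    qed
    have "emeasure (C 0 (Suc n) (\<lambda>_. undefined)) {u (Suc n)} =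
        (\<integral>\<^sup>+s. eP n s {u (Suc n)} \<partial>C 0 n (\<lambda>_. undefined))"
      unfolding C.simps add_0
      by (rule emeasure_bind[where N="PiM {0..<Suc n} (\<lambda>_. count_space UNIV)"])
        (use measurable_eP[of n] sets_C[OF un, of n] space_C[OF un, of n] sing[of "Suc n"] in
          \<open>auto simp: measurable_cong_sets[OF sets_C[OF un, of n]] space_PiM\<close>)
    also have "\<dots> = (\<integral>\<^sup>+s. ennreal ?p * indicator {u n} s \<partial>C 0 n (\<lambda>_. undefined))"
      using space_C[OF un, of n] by (intro nn_integral_cong e) simp
    also have "\<dots> = ennreal ?p * ennreal (?f n)"
      using sets_C[OF un, of n] sing[of n]
      by (subst nn_integral_cmult_indicator) (auto simp: Suc.IH)
    also have "\<dots> = ennreal (?f (Suc n))"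
      by (simp add: ennreal_mult' [symmetric] mult.commute)
    finally show ?case .
  qed
  have "{s. \<forall>i\<le>n. s i = t i} = PF.emb UNIV {0..<Suc n} {u (Suc n)}"
    by (auto simp: u_def prod_emb_def space_PiM fun_eq_iff restrict_def less_Suc_eq_le) metis
  then have "emeasure (markov_chain_law K x) {s. \<forall>i\<le>n. s i = t i} = CI {0..<Suc n} {u (Suc n)}"
    unfolding markov_chain_law_def by (simp only: lim[OF finite_atLeastLessThan sing])
  also have "\<dots> = C 0 (Suc n) (\<lambda>_. undefined) {u (Suc n)}"
    using sing[of "Suc n"] sets.sets_into_space[OF sing, of "Suc n"]
    by (subst emeasure_CI[OF subset_refl]) (auto simp: prod_emb_id space_PiM)
  also have "\<dots> = ennreal (?f (Suc n))" by (rule step)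
  also have "?f (Suc n) = (if t 0 = x then 1 else 0) * (\<Prod>i<n. pmf (K (t i)) (t (Suc i)))"
    by (subst prod.lessThan_Suc_shift) (auto simp: indicator_def)
  finally show ?thesis .
qed

end

(*
  Benjamini, Pemantle and Peres: a random oriented path whose position cannot be guessed from its
  past meets every fixed path only a number of times that has an exponential moment. Such a path is
  built from independent block parameters on all scales, moving in three coordinate directions. For
  p close to 1 the open paths, weighted by p^-length, therefore carry a flow whose strength
  concentrates and whose expected energy is bounded (second moment method). Counting only the edges
  after time T makes the variance small, so that with probability close to 1 a flow of finite energy
  leaves one of the vertices on level T. A finite energy flow excludes recurrence, because in the
  recurrent case the Dirichlet energies of the probabilities of hitting x within n steps tend to 0.
*)
theory Submission
  imports Defs
begin

section \<open>Hitting probabilities and a transience criterion\<close>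

text \<open>Three directions are needed because the number of steps is fixed: one direction absorbs
  the slack while the counts of the other two vary freely. Within time k the position can then be
  spread over about k^(4/3) sites, and k^(-4/3) is summable. With two directions only k + 1 sites
  are available, so the guessing probabilities could not be summable. Summability bounds an
  exponential moment of the number of common edges, with a base above 1 that does not depend on T,
  while the tail of the same series makes this moment close to 1. Hence one p serves every error
  probability, and probability 1 is reached without a zero-one law. No infinite flow is constructed.
  The transience test pairs flows only with finitely supported functions, so flows to level n for
  infinitely many n, with one source and one energy bound, are enough. The source may a priori vary
  with n, but only finitely many vertices of level T can be reached.\<close>

fun hit_within :: "('a \<Rightarrow> 'a pmf) \<Rightarrow> 'a \<Rightarrow> nat \<Rightarrow> 'a \<Rightarrow> real" where
  "hit_within K x 0 y = of_bool (y = x)"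
| "hit_within K x (Suc n) y =
    (if y = x then 1 else \<Sum>z\<in>set_pmf (K y). pmf (K y) z * hit_within K x n z)"

lemma hit_within_nonneg: "0 \<le> hit_within K x n y"
  by (induction n arbitrary: y) (auto intro!: sum_nonneg)

lemma hit_within_self [simp]: "hit_within K x n x = 1"
  by (cases n) auto

text \<open>Off \<open>x\<close> the right-hand side averages \<open>hit_within K x n\<close> over
  one step, so the inequality also says that this function is subharmonic away from
  \<open>x\<close>. Both readings are used.\<close>

lemma hit_within_Suc_mono: "hit_within K x n y \<le> hit_within K x (Suc n) y"
proof (induction n arbitrary: y)
  case 0
  then show ?case by (auto intro!: sum_nonneg)
next
  case (Suc n)
  have "(\<Sum>z\<in>set_pmf (K y). pmf (K y) z * hit_within K x n z)
      \<le> (\<Sum>z\<in>set_pmf (K y). pmf (K y) z * hit_within K x (Suc n) z)"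
    by (intro sum_mono mult_left_mono Suc.IH pmf_nonneg)
  then show ?case
    by (simp only: hit_within.simps(2)[of K x "Suc n" y] hit_within.simps(2)[of K x n y] split: if_split) simp
qed

lemma hit_within_mono: "m \<le> n \<Longrightarrow> hit_within K x m y \<le> hit_within K x n y"
  by (rule lift_Suc_mono_le[of "\<lambda>n. hit_within K x n y"]) (rule hit_within_Suc_mono)

section \<open>Hitting probabilities and the law of the chain\<close>

lemma measurable_markov_chain_component [measurable]:
  "(\<lambda>s. s i) \<in> markov_chain_law K x \<rightarrow>\<^sub>M count_space UNIV"
  by measurable

lemma emeasure_markov_chain_law_cylinder_Suc:
  "emeasure (markov_chain_law K x0) {s. \<forall>i\<le>Suc m. s i = (t(Suc m := z)) i} =
     emeasure (markov_chain_law K x0) {s. \<forall>i\<le>m. s i = t i} * ennreal (pmf (K (t m)) z)"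
proof -
  have "(\<Prod>i<m. pmf (K ((t(Suc m := z)) i)) ((t(Suc m := z)) (Suc i)))
      = (\<Prod>i<m. pmf (K (t i)) (t (Suc i)))"
    by (intro prod.cong) auto
  then show ?thesis
    unfolding emeasure_markov_chain_law_cylinder
    by (simp add: ennreal_mult'[symmetric] mult.assoc prod_nonneg)
qed

text \<open>This estimate on cylinders replaces the Markov property: a bound \<open>g\<close> valid
  after each prescribed next state is averaged with the transition probabilities, and no conditional
  law is formed.\<close>

lemma emeasure_markov_chain_law_step:
  fixes K :: "'a::countable \<Rightarrow> 'a pmf"
  assumes fin: "\<And>y. finite (set_pmf (K y))" and g: "\<And>z. 0 \<le> g z"
    and Q [measurable]: "Measurable.pred (markov_chain_law K x0) Q"
    and bound: "\<And>z. emeasure (markov_chain_law K x0) {s. (\<forall>i\<le>Suc m. s i = (t(Suc m := z)) i) \<and> Q s}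
      \<le> emeasure (markov_chain_law K x0) {s. \<forall>i\<le>Suc m. s i = (t(Suc m := z)) i} * ennreal (g z)"
  shows "emeasure (markov_chain_law K x0) {s. (\<forall>i\<le>m. s i = t i) \<and> Q s}
    \<le> emeasure (markov_chain_law K x0) {s. \<forall>i\<le>m. s i = t i} *
      ennreal (\<Sum>z\<in>set_pmf (K (t m)). pmf (K (t m)) z * g z)"
proof -
  let ?M = "markov_chain_law K x0"
  let ?C = "\<lambda>z. {s. \<forall>i\<le>Suc m. s i = (t(Suc m := z)) i}"
  let ?A = "\<lambda>z. {s. (\<forall>i\<le>Suc m. s i = (t(Suc m := z)) i) \<and> Q s}"
  let ?P = "set_pmf (K (t m))"
  have C[measurable]: "?C z \<in> sets ?M" for z
  proof -
    have "{s \<in> space ?M. \<forall>i\<le>Suc m. s i = (t(Suc m := z)) i} \<in> sets ?M" by measurable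
    then show ?thesis by simp
  qed
  have A[measurable]: "?A z \<in> sets ?M" for z
  proof -
    have "{s \<in> space ?M. (\<forall>i\<le>Suc m. s i = (t(Suc m := z)) i) \<and> Q s} \<in> sets ?M" by measurable
    then show ?thesis by simp
  qed
  \<comment> \<open>Countability of the state space makes the union over impossible next states
    null; the union that remains is finite.\<close>
  have null: "(\<Union>z\<in>-?P. ?C z) \<in> null_sets ?M"
  proof (rule null_sets_UN')
    fix z assume "z \<in> -?P"
    then have "pmf (K (t m)) z = 0" by (simp add: set_pmf_iff)
    then show "?C z \<in> null_sets ?M"
      using C by (intro null_setsI) (simp_all only: emeasure_markov_chain_law_cylinder_Suc, simp)
  qed simp
  have "{s. (\<forall>i\<le>m. s i = t i) \<and> Q s} \<subseteq> (\<Union>z\<in>?P. ?A z) \<union> (\<Union>z\<in>-?P. ?C z)"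
  proof
    fix s assume s: "s \<in> {s. (\<forall>i\<le>m. s i = t i) \<and> Q s}"
    then have "s \<in> ?A (s (Suc m))" by (auto simp: le_Suc_eq)
    then show "s \<in> (\<Union>z\<in>?P. ?A z) \<union> (\<Union>z\<in>-?P. ?C z)" by blast
  qed
  then have "emeasure ?M {s. (\<forall>i\<le>m. s i = t i) \<and> Q s} \<le> emeasure ?M ((\<Union>z\<in>?P. ?A z) \<union> (\<Union>z\<in>-?P. ?C z))"
    by (intro emeasure_mono sets.Un sets.finite_UN fin A null_setsD2[OF null])
  also have "\<dots> = emeasure ?M (\<Union>z\<in>?P. ?A z)"
    by (intro emeasure_Un_null_set null sets.finite_UN fin A)
  also have "\<dots> \<le> (\<Sum>z\<in>?P. emeasure ?M (?A z))"
    by (intro emeasure_subadditive_finite fin image_subsetI A)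
  also have "\<dots> \<le> (\<Sum>z\<in>?P. emeasure ?M {s. \<forall>i\<le>m. s i = t i} * ennreal (pmf (K (t m)) z * g z))"
  proof (rule sum_mono)
    fix z
    have "emeasure ?M (?A z) \<le> emeasure ?M (?C z) * ennreal (g z)" by (rule bound)
    also have "\<dots> = emeasure ?M {s. \<forall>i\<le>m. s i = t i} * ennreal (pmf (K (t m)) z * g z)"
      unfolding emeasure_markov_chain_law_cylinder_Suc by (simp add: ennreal_mult' mult.assoc g)
    finally show "emeasure ?M (?A z) \<le> \<dots>" .
  qed
  also have "\<dots> = emeasure ?M {s. \<forall>i\<le>m. s i = t i} * ennreal (\<Sum>z\<in>?P. pmf (K (t m)) z * g z)"
    by (simp add: sum_distrib_left[symmetric] sum_ennreal g)
  finally show ?thesis .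
qed

text \<open>An upper bound for the law is enough, since a certain return has to push the recursive
  values up to 1. Cylinders of arbitrary length \<open>m\<close> make the induction close: after one
  more step the past is again a cylinder.\<close>

lemma emeasure_markov_chain_law_hit_within:
  fixes K :: "'a::countable \<Rightarrow> 'a pmf"
  assumes fin: "\<And>y. finite (set_pmf (K y))"
  shows "emeasure (markov_chain_law K x0) {s. (\<forall>i\<le>m. s i = t i) \<and> (\<exists>k\<le>n. s (m + k) = x)}
    \<le> emeasure (markov_chain_law K x0) {s. \<forall>i\<le>m. s i = t i} * ennreal (hit_within K x n (t m))"
proof (induction n arbitrary: m t)
  case 0
  show ?case
  proof (cases "t m = x")
    case True
    have "{s. (\<forall>i\<le>m. s i = t i) \<and> (\<exists>k\<le>0. s (m + k) = x)} = {s. \<forall>i\<le>m. s i = t i}"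
      using True by auto
    then show ?thesis using True by simp
  next
    case False
    have "{s. (\<forall>i\<le>m. s i = t i) \<and> (\<exists>k\<le>0. s (m + k) = x)} = {}"
      using False by auto
    then show ?thesis by (simp only: emeasure_empty) simp
  qed
next
  case (Suc n)
  show ?case
  proof (cases "t m = x")
    case True
    have "{s. (\<forall>i\<le>m. s i = t i) \<and> (\<exists>k\<le>Suc n. s (m + k) = x)} = {s. \<forall>i\<le>m. s i = t i}"
      using True by (auto intro: exI[of _ 0])
    then show ?thesis using True by simp
  next
    case False
    have "{s. (\<forall>i\<le>m. s i = t i) \<and> (\<exists>k\<le>Suc n. s (m + k) = x)}
        = {s. (\<forall>i\<le>m. s i = t i) \<and> (\<exists>k\<le>n. s (Suc m + k) = x)}"
    proof (intro Collect_cong conj_cong refl)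
      fix s assume s: "\<forall>i\<le>m. s i = t i"
      show "(\<exists>k\<le>Suc n. s (m + k) = x) \<longleftrightarrow> (\<exists>k\<le>n. s (Suc m + k) = x)"
      proof
        assume "\<exists>k\<le>Suc n. s (m + k) = x"
        then obtain k where k: "k \<le> Suc n" "s (m + k) = x" by auto
        then have "k \<noteq> 0" using s False by (cases k) auto
        then show "\<exists>k\<le>n. s (Suc m + k) = x" using k by (cases k) auto
      next
        assume "\<exists>k\<le>n. s (Suc m + k) = x"
        then obtain k where "k \<le> n" "s (Suc m + k) = x" by auto
        then show "\<exists>k\<le>Suc n. s (m + k) = x" by (intro exI[of _ "Suc k"]) auto
      qed
    qed
    moreover have "emeasure (markov_chain_law K x0) {s. (\<forall>i\<le>m. s i = t i) \<and> (\<exists>k\<le>n. s (Suc m + k) = x)}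
      \<le> emeasure (markov_chain_law K x0) {s. \<forall>i\<le>m. s i = t i} *
        ennreal (\<Sum>z\<in>set_pmf (K (t m)). pmf (K (t m)) z * hit_within K x n z)"
    proof (rule emeasure_markov_chain_law_step[OF fin hit_within_nonneg])
      fix z
      show "emeasure (markov_chain_law K x0) {s. (\<forall>i\<le>Suc m. s i = (t(Suc m := z)) i) \<and> (\<exists>k\<le>n. s (Suc m + k) = x)}
        \<le> emeasure (markov_chain_law K x0) {s. \<forall>i\<le>Suc m. s i = (t(Suc m := z)) i} *
          ennreal (hit_within K x n z)"
        using Suc.IH[of "Suc m" "t(Suc m := z)"] by (simp only: fun_upd_same)
    qed measurable
    ultimately show ?thesis using False by simp
  qed
qed

text \<open>A return is counted from time 1 on, whereas \<open>hit_within\<close> is already 1 at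
  \<open>x\<close>. Hence one step is taken first, and the average over it appears instead of
  \<open>hit_within K x (Suc n) x\<close>.\<close>

lemma emeasure_return_within:
  fixes K :: "'a::countable \<Rightarrow> 'a pmf"
  assumes fin: "\<And>y. finite (set_pmf (K y))"
  shows "emeasure (markov_chain_law K x) {s. \<exists>k\<le>n. s (Suc k) = x}
    \<le> ennreal (\<Sum>z\<in>set_pmf (K x). pmf (K x) z * hit_within K x n z)"
proof -
  let ?M = "markov_chain_law K x"
  interpret prob_space ?M by (rule prob_space_markov_chain_law)
  have start: "emeasure ?M {s. \<forall>i\<le>0. s i = x} = 1"
    by (subst emeasure_markov_chain_law_cylinder) simp
  have meas: "{s. \<forall>i\<le>0. s i = x} \<in> events"
  proof -
    have "{s \<in> space ?M. \<forall>i\<le>0. s i = x} \<in> sets ?M" by measurable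
    then show ?thesis by simp
  qed
  have AE: "AE s in ?M. s 0 = x"
  proof -
    have "AE s in ?M. s \<in> {s. \<forall>i\<le>0. s i = x}"
      using start meas by (intro prob_eq_1[THEN iffD1]) (auto simp: emeasure_eq_measure)
    then show ?thesis by simp
  qed
  have "emeasure ?M {s. \<exists>k\<le>n. s (Suc k) = x} = emeasure ?M {s. (\<forall>i\<le>0. s i = x) \<and> (\<exists>k\<le>n. s (Suc 0 + k) = x)}"
  proof (rule emeasure_eq_AE)
    have "{s \<in> space ?M. \<exists>k\<le>n. s (Suc k) = x} \<in> sets ?M" by measurable
    then show "{s. \<exists>k\<le>n. s (Suc k) = x} \<in> sets ?M" by simp
    have "{s \<in> space ?M. (\<forall>i\<le>0. s i = x) \<and> (\<exists>k\<le>n. s (Suc 0 + k) = x)} \<in> sets ?M" by measurable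
    then show "{s. (\<forall>i\<le>0. s i = x) \<and> (\<exists>k\<le>n. s (Suc 0 + k) = x)} \<in> sets ?M" by simp
  qed (use AE in auto)
  also have "\<dots> \<le> emeasure ?M {s. \<forall>i\<le>0. s i = x} *
      ennreal (\<Sum>z\<in>set_pmf (K x). pmf (K x) z * hit_within K x n z)"
  proof (rule emeasure_markov_chain_law_step[OF fin hit_within_nonneg, where t="\<lambda>_. x"])
    fix z
    show "emeasure ?M {s. (\<forall>i\<le>Suc 0. s i = ((\<lambda>_. x)(Suc 0 := z)) i) \<and> (\<exists>k\<le>n. s (Suc 0 + k) = x)}
      \<le> emeasure ?M {s. \<forall>i\<le>Suc 0. s i = ((\<lambda>_. x)(Suc 0 := z)) i} * ennreal (hit_within K x n z)"
      using emeasure_markov_chain_law_hit_within[OF fin, where m="Suc 0" and t="(\<lambda>_. x)(Suc 0 := z)" and n=n and x=x and ?x0.0=x]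
      by (simp only: fun_upd_same)
  qed measurable
  finally show ?thesis using start by simp
qed

text \<open>Continuity from below for the increasing events of a return by a finite time. The amount
  by which the sum falls short of 1 will bound the Dirichlet energy up to a constant factor.\<close>

lemma recurrent_return_within:
  fixes K :: "'a::countable \<Rightarrow> 'a pmf"
  assumes fin: "\<And>y. finite (set_pmf (K y))"
    and rec: "1 \<le> measure (markov_chain_law K x) {s. \<exists>n>0. s n = x}" and "0 < \<epsilon>"
  shows "\<exists>n0. \<forall>n\<ge>n0. 1 - \<epsilon> < (\<Sum>z\<in>set_pmf (K x). pmf (K x) z * hit_within K x n z)"
proof -
  let ?M = "markov_chain_law K x"
  interpret prob_space ?M by (rule prob_space_markov_chain_law)
  define R where "R n = {s. \<exists>k\<le>n. s (Suc k) = x}" for n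
  have "R n \<in> events" for n
  proof -
    have "{s \<in> space ?M. \<exists>k\<le>n. s (Suc k) = x} \<in> sets ?M" by measurable
    then show ?thesis by (simp add: R_def)
  qed
  moreover have "incseq R" by (auto simp: R_def incseq_def intro: order_trans)
  ultimately have "(\<lambda>n. prob (R n)) \<longlonglongrightarrow> prob (\<Union>n. R n)"
    by (intro finite_Lim_measure_incseq) auto
  moreover have "(\<Union>n. R n) = {s. \<exists>n>0. s n = x}"
    by (auto simp: R_def gr0_conv_Suc)
  ultimately have "eventually (\<lambda>n. 1 - \<epsilon> < prob (R n)) sequentially"
    using rec \<open>0 < \<epsilon>\<close> by (intro order_tendstoD(1)) auto
  then obtain n0 where n0: "\<And>n. n \<ge> n0 \<Longrightarrow> 1 - \<epsilon> < prob (R n)"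
    by (auto simp: eventually_sequentially)
  have "prob (R n) \<le> (\<Sum>z\<in>set_pmf (K x). pmf (K x) z * hit_within K x n z)" for n
    using emeasure_return_within[of K x n, OF fin]
    by (simp add: R_def emeasure_eq_measure sum_nonneg hit_within_nonneg)
  with n0 show ?thesis by (meson less_le_trans)
qed

section \<open>Dirichlet energy and flows\<close>

definition neighbour_walk :: "('a \<Rightarrow> 'a set) \<Rightarrow> 'a \<Rightarrow> 'a pmf" where
  "neighbour_walk N y = (if N y = {} then return_pmf y else pmf_of_set (N y))"

lemma set_pmf_neighbour_walk:
  "finite (N y) \<Longrightarrow> set_pmf (neighbour_walk N y) = (if N y = {} then {y} else N y)"
  by (simp add: neighbour_walk_def)

text \<open>The degree is the reversible measure of the walk, so it converts the graph Laplacian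
  into the defect of averaging over one step. At an isolated vertex both sides vanish.\<close>

lemma neighbour_walk_laplacian:
  assumes "finite (N y)"
  shows "(\<Sum>z\<in>N y. f y - f z) =
    real (card (N y)) * (f y - (\<Sum>z\<in>set_pmf (neighbour_walk N y). pmf (neighbour_walk N y) z * f z))"
proof (cases "N y = {}")
  case False
  then have "(\<Sum>z\<in>set_pmf (neighbour_walk N y). pmf (neighbour_walk N y) z * f z) = (\<Sum>z\<in>N y. f z) / card (N y)"
    using assms by (simp add: neighbour_walk_def sum_divide_distrib)
  then show ?thesis using False assms by (simp add: sum_subtractf field_simps)
qed simp

text \<open>Each undirected edge is listed in both directions, whence the factor 2.\<close>

lemma dirichlet_green:
  fixes f :: "'a \<Rightarrow> real"
  assumes N: "\<And>y. finite (N y)" "\<And>y z. z \<in> N y \<Longrightarrow> y \<in> N z"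
    and B: "finite B" "\<And>y. y \<notin> B \<Longrightarrow> f y = 0"
  defines "E \<equiv> {(y, z). z \<in> N y \<and> (y \<in> B \<or> z \<in> B)}"
  shows "finite E" "(\<Sum>(y, z)\<in>E. (f y - f z)\<^sup>2) = 2 * (\<Sum>y\<in>B. f y * (\<Sum>z\<in>N y. f y - f z))"
proof -
  have sub: "E \<subseteq> Sigma B N \<union> prod.swap ` Sigma B N"
    using N(2) by (force simp: E_def)
  then show fin: "finite E" by (rule finite_subset) (use N(1) B(1) in auto)
  have swap: "(\<Sum>(y, z)\<in>E. f z * (f z - f y)) = (\<Sum>(y, z)\<in>E. f y * (f y - f z))"
    by (rule sum.reindex_bij_witness[of _ prod.swap prod.swap]) (use N(2) in \<open>auto simp: E_def\<close>)
  have "(\<Sum>(y, z)\<in>E. (f y - f z)\<^sup>2) = (\<Sum>(y, z)\<in>E. f y * (f y - f z)) + (\<Sum>(y, z)\<in>E. f z * (f z - f y))"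
    unfolding sum.distrib[symmetric] by (intro sum.cong) (auto simp: power2_eq_square algebra_simps)
  also have "\<dots> = 2 * (\<Sum>(y, z)\<in>E. f y * (f y - f z))" by (simp add: swap)
  also have "(\<Sum>(y, z)\<in>E. f y * (f y - f z)) = (\<Sum>(y, z)\<in>Sigma B N. f y * (f y - f z))"
    by (rule sum.mono_neutral_right) (use fin B(2) in \<open>auto simp: E_def, metis\<close>)
  also have "\<dots> = (\<Sum>y\<in>B. f y * (\<Sum>z\<in>N y. f y - f z))"
    using B(1) N(1) by (simp add: sum.Sigma[symmetric] sum_distrib_left)
  finally show "(\<Sum>(y, z)\<in>E. (f y - f z)\<^sup>2) = 2 * (\<Sum>y\<in>B. f y * (\<Sum>z\<in>N y. f y - f z))" .
qed

text \<open>Each step adds to the support at most the points with a neighbour in the old support; by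
  the symmetry of \<open>N\<close> these are neighbours of it, hence finitely many.\<close>

lemma finite_support_hit_within:
  assumes N: "\<And>y. finite (N y)" "\<And>y z. z \<in> N y \<Longrightarrow> y \<in> N z"
  shows "finite {y. hit_within (neighbour_walk N) x n y \<noteq> 0}"
proof (induction n)
  case (Suc n)
  let ?S = "{y. hit_within (neighbour_walk N) x n y \<noteq> 0}"
  have "{y. hit_within (neighbour_walk N) x (Suc n) y \<noteq> 0} \<subseteq> insert x (?S \<union> (\<Union>z\<in>?S. N z))"
  proof
    fix y assume "y \<in> {y. hit_within (neighbour_walk N) x (Suc n) y \<noteq> 0}"
    then consider "y = x" | z where "z \<in> set_pmf (neighbour_walk N y)" "hit_within (neighbour_walk N) x n z \<noteq> 0"
      by (auto simp: sum_eq_0_iff split: if_splits elim!: sum.not_neutral_contains_not_neutral)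
    then show "y \<in> insert x (?S \<union> (\<Union>z\<in>?S. N z))"
      using N by cases (auto simp: set_pmf_neighbour_walk split: if_splits)
  qed
  then show ?case by (rule finite_subset) (use Suc N in auto)
qed simp

text \<open>The hypothesis \<open>flow\<close> is what a unit flow of energy at most \<open>M\<close> from \<open>v\<close> to infinity provides.
  In the recurrent case the energies of the functions \<open>hit_within K x n\<close> tend to 0, contradicting
  the Cauchy-Schwarz inequality for the pairing with such flows.\<close>

lemma transient_if_finite_energy_flow:
  fixes N :: "'a::countable \<Rightarrow> 'a set"
  assumes N: "\<And>y. finite (N y)" "\<And>y z. z \<in> N y \<Longrightarrow> y \<in> N z"
    and pos: "0 < hit_within (neighbour_walk N) x m v" and "0 < c"
    and flow: "\<And>h :: 'a \<Rightarrow> real. finite {y. h y \<noteq> 0} \<Longrightarrow> \<exists>F \<theta>. finite F \<and> (\<forall>(y, z)\<in>F. z \<in> N y) \<and>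
       (\<Sum>e\<in>F. (\<theta> e)\<^sup>2) \<le> M \<and> c * h v \<le> (\<Sum>(y, z)\<in>F. \<theta> (y, z) * (h y - h z))"
  shows "measure (markov_chain_law (neighbour_walk N) x) {s. \<exists>n>0. s n = x} < 1"
proof (rule ccontr)
  let ?K = "neighbour_walk N"
  let ?h = "hit_within ?K x"
  let ?P = "\<lambda>g y. \<Sum>z\<in>set_pmf (?K y). pmf (?K y) z * g z"
  assume "\<not> ?thesis"
  then have rec: "1 \<le> measure (markov_chain_law ?K x) {s. \<exists>n>0. s n = x}" by simp
  have fin: "finite (set_pmf (?K y))" for y using N by (simp add: set_pmf_neighbour_walk)
  \<comment> \<open>Lower bound for the squared pairing, uniform in \<open>n \<ge> m\<close> because
    \<open>hit_within\<close> at \<open>v\<close> grows with \<open>n\<close>.\<close>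
  define \<delta> where "\<delta> = (c * ?h m v)\<^sup>2"
  have \<delta>: "0 < \<delta>" using pos \<open>0 < c\<close> by (simp add: \<delta>_def)
  have key: "\<delta> \<le> \<bar>M\<bar> * (2 * (card (N x) * (1 - ?P (?h n) x)))" if "m \<le> n" for n
  proof -
    define B where "B = insert x {y. ?h n y \<noteq> 0}"
    define E where "E = {(y, z). z \<in> N y \<and> (y \<in> B \<or> z \<in> B)}"
    have B: "finite B" "\<And>y. y \<notin> B \<Longrightarrow> ?h n y = 0"
      using finite_support_hit_within[of N x n] N by (auto simp: B_def)
    have xB: "x \<in> B" by (simp add: B_def)
    have lap: "(\<Sum>z\<in>N y. ?h n y - ?h n z) = card (N y) * (?h n y - ?P (?h n) y)" for y
      by (rule neighbour_walk_laplacian[OF N(1)])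
    note green = dirichlet_green[of N B "?h n", OF N B, folded E_def]
    obtain F \<theta> where F: "finite F" "\<forall>(y, z)\<in>F. z \<in> N y" "(\<Sum>e\<in>F. (\<theta> e)\<^sup>2) \<le> M"
        and le: "c * ?h n v \<le> (\<Sum>(y, z)\<in>F. \<theta> (y, z) * (?h n y - ?h n z))"
      using flow[OF finite_support_hit_within[of N x n]] N by blast
    \<comment> \<open>Away from \<open>x\<close> the function is nonnegative and subharmonic, so its
      terms are at most 0; only the term at \<open>x\<close> can contribute to the energy.\<close>
    have "(\<Sum>y\<in>B. ?h n y * (\<Sum>z\<in>N y. ?h n y - ?h n z)) \<le> (\<Sum>y\<in>B. if y = x then card (N x) * (1 - ?P (?h n) x) else 0)"
    proof (rule sum_mono)
      fix y assume "y \<in> B"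
      show "?h n y * (\<Sum>z\<in>N y. ?h n y - ?h n z) \<le> (if y = x then card (N x) * (1 - ?P (?h n) x) else 0)"
      proof (cases "y = x")
        case False
        then have "?h n y \<le> ?P (?h n) y" using hit_within_Suc_mono[of ?K x n y] by simp
        then have "(\<Sum>z\<in>N y. ?h n y - ?h n z) \<le> 0"
          unfolding lap by (simp add: mult_nonneg_nonpos)
        then show ?thesis using False hit_within_nonneg[of ?K x n y] by (simp add: mult_nonneg_nonpos)
      next
        case True
        show ?thesis by (simp only: True lap) simp
      qed
    qed
    also have "\<dots> = card (N x) * (1 - ?P (?h n) x)" using B(1) xB by simp
    finally have Green_le: "(\<Sum>y\<in>B. ?h n y * (\<Sum>z\<in>N y. ?h n y - ?h n z)) \<le> card (N x) * (1 - ?P (?h n) x)" .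
    have "(\<Sum>(y, z)\<in>F. (?h n y - ?h n z)\<^sup>2) = (\<Sum>(y, z)\<in>F \<inter> E. (?h n y - ?h n z)\<^sup>2)"
      by (rule sum.mono_neutral_right) (use F B(2) in \<open>auto simp: E_def, metis\<close>)
    also have "\<dots> \<le> (\<Sum>(y, z)\<in>E. (?h n y - ?h n z)\<^sup>2)"
      by (rule sum_mono2) (use green(1) in auto)
    also have "\<dots> = 2 * (\<Sum>y\<in>B. ?h n y * (\<Sum>z\<in>N y. ?h n y - ?h n z))" by (rule green(2))
    finally have energy: "(\<Sum>(y, z)\<in>F. (?h n y - ?h n z)\<^sup>2) \<le> 2 * (card (N x) * (1 - ?P (?h n) x))" using Green_le by simp
    have "c * ?h m v \<le> (\<Sum>(y, z)\<in>F. \<theta> (y, z) * (?h n y - ?h n z))"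
      using le hit_within_mono[OF that, of ?K x v] \<open>0 < c\<close> by (meson mult_left_mono less_imp_le order_trans)
    then have "\<delta> \<le> (\<Sum>(y, z)\<in>F. \<theta> (y, z) * (?h n y - ?h n z))\<^sup>2"
      unfolding \<delta>_def by (intro power_mono) (use pos \<open>0 < c\<close> in auto)
    also have "\<dots> = (\<Sum>e\<in>F. \<theta> e * (?h n (fst e) - ?h n (snd e)))\<^sup>2" by (simp add: case_prod_beta)
    also have "\<dots> \<le> (\<Sum>e\<in>F. (\<theta> e)\<^sup>2) * (\<Sum>e\<in>F. (?h n (fst e) - ?h n (snd e))\<^sup>2)"
      by (rule Cauchy_Schwarz_ineq_sum)
    also have "\<dots> \<le> \<bar>M\<bar> * (2 * (card (N x) * (1 - ?P (?h n) x)))"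
      using energy F(3) by (intro mult_mono) (auto simp: case_prod_beta intro!: sum_nonneg)
    finally show ?thesis .
  qed
  \<comment> \<open>Chosen so that
    \<open>2 * \<bar>M\<bar> * card (N x) * \<epsilon> < \<delta>\<close>; the \<open>+ 1\<close>
    keeps the denominator positive and the inequality strict.\<close>
  define \<epsilon> where "\<epsilon> = \<delta> / (2 * \<bar>M\<bar> * card (N x) + 1)"
  have "0 < \<epsilon>" using \<delta> by (simp add: \<epsilon>_def add_nonneg_pos)
  then obtain n0 where n0: "\<And>n. n \<ge> n0 \<Longrightarrow> 1 - \<epsilon> < ?P (?h n) x"
    using recurrent_return_within[OF fin rec] by blast
  define n where "n = max m n0"
  have "1 - ?P (?h n) x \<le> \<epsilon>" using n0[of n] by (simp add: n_def)
  then have "\<bar>M\<bar> * (2 * (card (N x) * (1 - ?P (?h n) x))) \<le> \<bar>M\<bar> * (2 * (card (N x) * \<epsilon>))"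
    by (intro mult_left_mono) auto
  then have "\<delta> \<le> 2 * \<bar>M\<bar> * card (N x) * \<epsilon>" using key[of n] by (simp add: n_def mult_ac)
  also have "\<dots> < (2 * \<bar>M\<bar> * card (N x) + 1) * \<epsilon>" using \<open>0 < \<epsilon>\<close> by (simp add: algebra_simps)
  also have "\<dots> = \<delta>" unfolding \<epsilon>_def by (simp add: add_nonneg_eq_0_iff)
  finally show False by simp
qed

section \<open>Oriented open clusters\<close>

text \<open>Every directed edge raises the level by one. The level therefore excludes directed
  cycles and serves as the clock of a directed path.\<close>

definition level :: "int ^ 'd \<Rightarrow> int" where
  "level x = (\<Sum>i\<in>UNIV. x $ i)"

lemma level_zero [simp]: "level 0 = 0"
  by (simp add: level_def)

lemma level_add_axis [simp]: "level (x + axis i 1) = level x + 1"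
  by (simp add: level_def sum.distrib axis_def)

lemma parcs_open_digraph: "parcs (open_digraph \<omega>) = {e \<in> parcs Zd_digraph. \<omega> e}"
  by (simp add: open_digraph_def)

lemma Zd_arcs_iff: "(x, y) \<in> parcs Zd_digraph \<longleftrightarrow> (\<exists>i. y = x + axis i 1)"
  by (auto simp: Zd_digraph_def)

text \<open>The level bound is the invariant of the induction: the rest of the walk lies strictly
  above \<open>u\<close>, so \<open>u\<close> is not visited again. Directed walks are thus
  paths.\<close>

lemma level_less_awalk_verts:
  assumes "set es \<subseteq> parcs Zd_digraph" "pcas u es w"
  shows "distinct (pawalk_verts u es) \<and> (\<forall>x\<in>set (pawalk_verts u es). level u \<le> level x)"
  using assms
proof (induction es arbitrary: u)
  case (Cons e es)
  obtain a b where e: "e = (a, b)" by (cases e)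
  from Cons.prems have [simp]: "a = u" and cas: "pcas b es w" and "(u, b) \<in> parcs Zd_digraph"
    by (auto simp: e)
  then have "level u < level b" by (auto simp: Zd_arcs_iff)
  with Cons.IH[of b] cas Cons.prems(1) show ?case by (fastforce simp: e)
qed simp

lemma apath_open_digraph:
  "pre_digraph.apath (open_digraph \<omega>) v es w \<longleftrightarrow> set es \<subseteq> parcs (open_digraph \<omega>) \<and> pcas v es w"
  using level_less_awalk_verts[of es v w]
  by (auto simp: pre_digraph.apath_def pre_digraph.awalk_def cas_with_proj_eq awalk_verts_with_proj_eq
      parcs_open_digraph open_digraph_def)

lemma pcas_append: "pcas u (es @ es') w \<longleftrightarrow> (\<exists>x. pcas u es x \<and> pcas x es' w)"
  by (induction es arbitrary: u) auto

lemma pcas_rtrancl: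
  assumes "pcas u es w" "set es \<subseteq> A"
  shows "(\<forall>x\<in>set (pawalk_verts u es). (u, x) \<in> A\<^sup>*) \<and> (\<forall>e\<in>set es. (u, fst e) \<in> A\<^sup>*)"
  using assms
proof (induction es arbitrary: u)
  case (Cons e es)
  obtain a b where e: "e = (a, b)" by (cases e)
  with Cons.prems have "(u, b) \<in> A" by auto
  with Cons.IH[of b] Cons.prems show ?case
    by (auto simp: e intro: converse_rtrancl_into_rtrancl)
qed simp

lemma rtrancl_pcas:
  assumes "(u, x) \<in> A\<^sup>*"
  shows "\<exists>es. pcas u es x \<and> set es \<subseteq> A"
  using assms
proof induction
  case base
  show ?case by (intro exI[of _ "[]"]) simp
next
  case (step y z)
  then obtain es where "pcas u es y" "set es \<subseteq> A" by blast
  with step show ?case by (intro exI[of _ "es @ [(y, z)]"]) (auto simp: pcas_append)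
qed

lemma pcas_end_in_verts: "pcas u es w \<Longrightarrow> w \<in> set (pawalk_verts u es)"
  by (induction es arbitrary: u) auto

lemma pverts_oriented_cluster:
  "pverts (oriented_cluster \<omega> v) = (parcs (open_digraph \<omega>))\<^sup>* `` {v}" (is "_ = ?O\<^sup>* `` {v}")
proof -
  have "pverts (oriented_cluster \<omega> v) =
      (\<Union>es\<in>{es. \<exists>w. set es \<subseteq> ?O \<and> pcas v es w}. set (pawalk_verts v es))"
    by (simp add: oriented_cluster_def apath_open_digraph awalk_verts_with_proj_eq)
  also have "\<dots> = ?O\<^sup>* `` {v}"
  proof (intro equalityI subsetI)
    fix x assume "x \<in> (\<Union>es\<in>{es. \<exists>w. set es \<subseteq> ?O \<and> pcas v es w}. set (pawalk_verts v es))"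
    then obtain es w where "set es \<subseteq> ?O" "pcas v es w" "x \<in> set (pawalk_verts v es)" by blast
    then show "x \<in> ?O\<^sup>* `` {v}" using pcas_rtrancl[of v es w ?O] by simp
  next
    fix x assume "x \<in> ?O\<^sup>* `` {v}"
    then obtain es where "pcas v es x" "set es \<subseteq> ?O" using rtrancl_pcas[of v x ?O] by auto
    then show "x \<in> (\<Union>es\<in>{es. \<exists>w. set es \<subseteq> ?O \<and> pcas v es w}. set (pawalk_verts v es))"
      using pcas_end_in_verts[of v es x] by blast
  qed
  finally show ?thesis .
qed

text \<open>An open path to the tail of an open edge can be prolonged by that edge, and the result
  is again a path because directed walks never repeat a vertex.\<close>

lemma parcs_oriented_cluster:
  "parcs (oriented_cluster \<omega> v) =
    {e \<in> parcs (open_digraph \<omega>). fst e \<in> (parcs (open_digraph \<omega>))\<^sup>* `` {v}}"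
    (is "_ = {e \<in> ?O. fst e \<in> ?O\<^sup>* `` {v}}")
proof -
  have "parcs (oriented_cluster \<omega> v) = (\<Union>es\<in>{es. \<exists>w. set es \<subseteq> ?O \<and> pcas v es w}. set es)"
    by (simp add: oriented_cluster_def apath_open_digraph)
  also have "\<dots> = {e \<in> ?O. fst e \<in> ?O\<^sup>* `` {v}}"
  proof (intro equalityI subsetI)
    fix e assume "e \<in> (\<Union>es\<in>{es. \<exists>w. set es \<subseteq> ?O \<and> pcas v es w}. set es)"
    then obtain es w where "set es \<subseteq> ?O" "pcas v es w" "e \<in> set es" by blast
    then show "e \<in> {e \<in> ?O. fst e \<in> ?O\<^sup>* `` {v}}" using pcas_rtrancl[of v es w ?O] by auto
  next
    fix e assume e: "e \<in> {e \<in> ?O. fst e \<in> ?O\<^sup>* `` {v}}"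
    then obtain es where "pcas v es (fst e)" "set es \<subseteq> ?O" using rtrancl_pcas[of v "fst e" ?O] by auto
    with e have "set (es @ [e]) \<subseteq> ?O" "pcas v (es @ [e]) (snd e)" by (simp_all add: pcas_append)
    then show "e \<in> (\<Union>es\<in>{es. \<exists>w. set es \<subseteq> ?O \<and> pcas v es w}. set es)"
      by (intro UN_I[of "es @ [e]"] CollectI exI conjI) auto
  qed
  finally show ?thesis .
qed

text \<open>The flow leaves \<open>v\<close>, while transience concerns every start \<open>x\<close>
  in the cluster. An open path from \<open>v\<close> to \<open>x\<close> bridges the gap: along it
  the walk from \<open>v\<close> reaches \<open>x\<close> with positive probability.\<close>

lemma transient_graph_oriented_cluster:
  fixes v :: "int ^ 'd::finite"
  assumes "0 < c"
    and flow: "\<And>h :: int ^ 'd \<Rightarrow> real. finite {y. h y \<noteq> 0} \<Longrightarrow>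
      \<exists>F \<theta>. finite F \<and> F \<subseteq> parcs (oriented_cluster \<omega> v) \<and>
       (\<Sum>e\<in>F. (\<theta> e)\<^sup>2) \<le> M \<and> c * h v \<le> (\<Sum>(y, z)\<in>F. \<theta> (y, z) * (h y - h z))"
  shows "transient_graph (oriented_cluster \<omega> v)"
proof -
  let ?G = "oriented_cluster \<omega> v" and ?O = "parcs (open_digraph \<omega>)"
  define N where "N y = {z. (y, z) \<in> parcs ?G \<or> (z, y) \<in> parcs ?G}" for y
  have sym: "parcs (mk_symmetric ?G) = {(y, z). z \<in> N y}"
    by (force simp: parcs_mk_symmetric N_def)
  have walk: "simple_random_walk ?G = neighbour_walk N"
    by (auto simp: fun_eq_iff simple_random_walk_def neighbour_walk_def sym Let_def)
  have N_fin: "finite (N y)" for y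
  proof (rule finite_subset)
    show "N y \<subseteq> range (\<lambda>i. y + axis i 1) \<union> range (\<lambda>i. y - axis i 1)"
      by (auto simp: N_def parcs_oriented_cluster parcs_open_digraph Zd_arcs_iff)
  qed simp
  have N_sym: "y \<in> N z" if "z \<in> N y" for y z using that by (auto simp: N_def)
  have verts: "pverts ?G = {x. (v, x) \<in> ?O\<^sup>*}" by (auto simp: pverts_oriented_cluster)
  interpret S: pair_wf_digraph "mk_symmetric ?G"
  proof
    fix e assume "e \<in> parcs (mk_symmetric ?G)"
    then have "fst e \<in> pverts ?G \<and> snd e \<in> pverts ?G"
      by (auto simp: sym N_def parcs_oriented_cluster verts intro: rtrancl_into_rtrancl)
    then show "fst e \<in> pverts (mk_symmetric ?G)" "snd e \<in> pverts (mk_symmetric ?G)" by simp_all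
  qed
  have "v \<rightarrow>\<^sup>*\<^bsub>mk_symmetric ?G\<^esub> x \<and> x \<rightarrow>\<^sup>*\<^bsub>mk_symmetric ?G\<^esub> v" if "(v, x) \<in> ?O\<^sup>*" for x
    using that
  proof induction
    case base
    then show ?case by (auto simp: verts)
  next
    case (step y z)
    then have "(y, z) \<in> parcs ?G" by (simp add: parcs_oriented_cluster)
    then have "(y, z) \<in> parcs (mk_symmetric ?G)" "(z, y) \<in> parcs (mk_symmetric ?G)"
      by (simp_all add: sym N_def)
    with step.IH show ?case
      by (meson S.reachable_adj_trans S.adj_reachable_trans)
  qed
  then have conn: "Digraph_Component.connected ?G"
    unfolding connected_def
    by (intro strongly_connectedI) (auto simp: verts intro: S.reachable_trans)
  have "measure (markov_chain_law (neighbour_walk N) x) {s. \<exists>n>0. s n = x} < 1" if x: "(v, x) \<in> ?O\<^sup>*" for x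
  proof -
    \<comment> \<open>Backward induction along the path from \<open>a\<close> to \<open>x\<close>;
      reachability of \<open>a\<close> from \<open>v\<close> keeps its edges inside the
      cluster.\<close>
    have "(v, a) \<in> ?O\<^sup>* \<longrightarrow> (\<exists>m. 0 < hit_within (neighbour_walk N) x m a)" if "(a, x) \<in> ?O\<^sup>*" for a
      using that
    proof (induction rule: converse_rtrancl_induct)
      case base
      show ?case by (auto intro: exI[of _ 0])
    next
      case (step a b)
      show ?case
      proof
        assume a: "(v, a) \<in> ?O\<^sup>*"
        with step obtain m where m: "0 < hit_within (neighbour_walk N) x m b"
          by (meson rtrancl_into_rtrancl)
        have b: "b \<in> set_pmf (neighbour_walk N a)"
        proof -
          have "b \<in> N a" using a step(1) by (simp add: N_def parcs_oriented_cluster)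
          then show ?thesis by (auto simp: set_pmf_neighbour_walk[OF N_fin])
        qed
        have fin: "finite (set_pmf (neighbour_walk N a))"
          using N_fin by (simp add: set_pmf_neighbour_walk)
        have "0 < pmf (neighbour_walk N a) b * hit_within (neighbour_walk N) x m b"
          using m b by (simp add: pmf_positive)
        also have "\<dots> \<le> (\<Sum>z\<in>set_pmf (neighbour_walk N a). pmf (neighbour_walk N a) z * hit_within (neighbour_walk N) x m z)"
          by (rule member_le_sum[OF b _ fin]) (simp add: hit_within_nonneg)
        finally have "0 < hit_within (neighbour_walk N) x (Suc m) a" by simp
        then show "\<exists>m. 0 < hit_within (neighbour_walk N) x m a" ..
      qed
    qed
    then obtain m where m: "0 < hit_within (neighbour_walk N) x m v" using x by blast
    show ?thesis
    proof (rule transient_if_finite_energy_flow[where N=N and M=M, OF N_fin N_sym m \<open>0 < c\<close>])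
      fix h :: "int ^ 'd \<Rightarrow> real"
      assume "finite {y. h y \<noteq> 0}"
      from flow[OF this] obtain F \<theta> where "finite F" "F \<subseteq> parcs ?G" "(\<Sum>e\<in>F. (\<theta> e)\<^sup>2) \<le> M"
        "c * h v \<le> (\<Sum>(y, z)\<in>F. \<theta> (y, z) * (h y - h z))" by blast
      then show "\<exists>F \<theta>. finite F \<and> (\<forall>(y, z)\<in>F. z \<in> N y) \<and> (\<Sum>e\<in>F. (\<theta> e)\<^sup>2) \<le> M \<and>
          c * h v \<le> (\<Sum>(y, z)\<in>F. \<theta> (y, z) * (h y - h z))"
        by (intro exI[of _ F] exI[of _ \<theta>]) (auto simp: N_def)
    qed
  qed
  with conn show ?thesis
    by (simp add: transient_graph_def transient_chain_def walk verts)
qed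

section \<open>Unpredictable oriented paths\<close>

text \<open>If a random path cannot be guessed from its past, then the number of its meetings with any
  deterministic path has an exponential moment: expand \<open>(1 + s) ^ N\<close> over the last meeting.\<close>

lemma unpredictable_meetings_moment:
  fixes X :: "'u \<Rightarrow> nat \<Rightarrow> 'v" and a :: "nat \<Rightarrow> real"
  assumes a: "\<And>k. 0 \<le> a k" "summable a" and s: "0 \<le> s" "s * (\<Sum>k. a k) \<le> 1 / 2"
    and pred: "\<And>j k y g. \<lbrakk>j < k; k \<le> n; \<And>u. 0 \<le> g u;
        \<And>u u'. \<lbrakk>u \<in> \<Omega>; u' \<in> \<Omega>; \<forall>i\<le>j. X u i = X u' i\<rbrakk> \<Longrightarrow> g u = g u'\<rbrakk> \<Longrightarrow>
      (\<Sum>u\<in>\<Omega>. of_bool (X u k = y) * g u) \<le> a (k - j) * (\<Sum>u\<in>\<Omega>. g u)"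
  shows "(\<Sum>u\<in>\<Omega>. (1 + s) ^ card {k\<in>{T<..n}. X u k = Y k})
    \<le> real (card \<Omega>) * (1 + 2 * s * (\<Sum>k\<in>{T<..n}. a k))"
proof -
  define C where "C u k = card {i\<in>{T<..<k}. X u i = Y i}" for u k
  define H where "H k = (\<Sum>u\<in>\<Omega>. of_bool (X u k = Y k) * (1 + s) ^ C u k)" for k
  have H_nonneg: "0 \<le> H k" for k using s by (auto simp: H_def intro!: sum_nonneg)
  \<comment> \<open>Each meeting multiplies the power by \<open>1 + s\<close>, that is, adds
    \<open>s\<close> times its previous value.\<close>
  have telescope: "(1 + s) ^ C u m = 1 + s * (\<Sum>k\<in>{T<..<m}. of_bool (X u k = Y k) * (1 + s) ^ C u k)" for u m
  proof (induction m)
    case (Suc m)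
    show ?case
    proof (cases "T < m")
      case True
      then have ins: "{T<..<Suc m} = insert m {T<..<m}" by auto
      have "{i\<in>{T<..<Suc m}. X u i = Y i} =
          (if X u m = Y m then insert m {i\<in>{T<..<m}. X u i = Y i} else {i\<in>{T<..<m}. X u i = Y i})"
        using True by (auto simp: less_Suc_eq)
      then have "C u (Suc m) = C u m + of_bool (X u m = Y m)" by (simp add: C_def)
      then have "(1 + s) ^ C u (Suc m) = (1 + s) ^ C u m + s * (of_bool (X u m = Y m) * (1 + s) ^ C u m)"
        by (simp add: algebra_simps)
      with Suc.IH show ?thesis by (simp add: ins algebra_simps)
    next
      case False
      then have "{T<..<Suc m} = {}" by auto
      then show ?thesis by (simp add: C_def)
    qed
  qed (simp add: C_def)
  \<comment> \<open>The weight of the past is expanded again over earlier meetings \<open>j\<close>.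
    Unpredictability is then used from time 0 with weight 1, and from time \<open>j\<close> with a
    weight that depends only on the path up to \<open>j\<close>.\<close>
  have rec: "H k \<le> a k * card \<Omega> + s * (\<Sum>j\<in>{T<..<k}. a (k - j) * H j)" if k: "T < k" "k \<le> n" for k
  proof -
    have "of_bool (X u k = Y k) * (1 + s) ^ C u k = of_bool (X u k = Y k) * 1 + s * (\<Sum>j\<in>{T<..<k}.
        of_bool (X u k = Y k) * (of_bool (X u j = Y j) * (1 + s) ^ C u j))" for u
      unfolding telescope[of u k] sum_distrib_left[symmetric] by (simp only: distrib_left mult.left_commute)
    then have "H k = (\<Sum>u\<in>\<Omega>. of_bool (X u k = Y k) * 1) + s * (\<Sum>j\<in>{T<..<k}. \<Sum>u\<in>\<Omega>.
        of_bool (X u k = Y k) * (of_bool (X u j = Y j) * (1 + s) ^ C u j))"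
      by (subst sum.swap) (simp only: H_def sum.distrib sum_distrib_left[of s])
    also have "(\<Sum>u\<in>\<Omega>. of_bool (X u k = Y k) * 1) \<le> a (k - 0) * (\<Sum>u\<in>\<Omega>. 1)"
      by (rule pred) (use k in auto)
    also have "(\<Sum>j\<in>{T<..<k}. \<Sum>u\<in>\<Omega>. of_bool (X u k = Y k) * (of_bool (X u j = Y j) * (1 + s) ^ C u j))
        \<le> (\<Sum>j\<in>{T<..<k}. a (k - j) * H j)"
      unfolding H_def
    proof (intro sum_mono pred)
      fix j u u' assume j: "j \<in> {T<..<k}" and "\<forall>i\<le>j. X u i = X u' i"
      then have "{i\<in>{T<..<j}. X u i = Y i} = {i\<in>{T<..<j}. X u' i = Y i}" "X u j = X u' j" by auto
      then show "of_bool (X u j = Y j) * (1 + s) ^ C u j = of_bool (X u' j = Y j) * (1 + s) ^ C u' j"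
        by (simp add: C_def)
    qed (use k s in auto)
    finally show ?thesis using s by (simp add: mult_left_mono)
  qed
  define S where "S = (\<Sum>k\<in>{T<..n}. H k)"
  define A where "A = (\<Sum>k. a k)"
  have "S \<le> (\<Sum>k\<in>{T<..n}. a k * card \<Omega> + s * (\<Sum>j\<in>{T<..<k}. a (k - j) * H j))"
    unfolding S_def by (intro sum_mono rec) auto
  also have "\<dots> = card \<Omega> * (\<Sum>k\<in>{T<..n}. a k) + s * (\<Sum>k\<in>{T<..n}. \<Sum>j\<in>{T<..<k}. a (k - j) * H j)"
    by (simp add: sum.distrib sum_distrib_left sum_distrib_right mult_ac)
  also have "(\<Sum>k\<in>{T<..n}. \<Sum>j\<in>{T<..<k}. a (k - j) * H j) = (\<Sum>j\<in>{T<..n}. \<Sum>k\<in>{j<..n}. a (k - j) * H j)"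
    unfolding sum.Sigma[OF finite_greaterThanAtMost ballI[OF finite_greaterThanLessThan]]
      sum.Sigma[OF finite_greaterThanAtMost ballI[OF finite_greaterThanAtMost]]
    by (rule sum.reindex_bij_witness[of _ prod.swap prod.swap]) auto
  also have "\<dots> \<le> (\<Sum>j\<in>{T<..n}. A * H j)"
  proof (rule sum_mono)
    fix j
    have "(\<Sum>k\<in>{j<..n}. a (k - j)) = (\<Sum>k\<in>{1..n - j}. a k)"
      by (rule sum.reindex_bij_witness[of _ "\<lambda>k. k + j" "\<lambda>k. k - j"]) auto
    also have "\<dots> \<le> A" unfolding A_def by (rule sum_le_suminf) (use a in auto)
    finally show "(\<Sum>k\<in>{j<..n}. a (k - j) * H j) \<le> A * H j"
      by (simp add: sum_distrib_right[symmetric] mult_right_mono H_nonneg)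
  qed
  also have "(\<Sum>j\<in>{T<..n}. A * H j) = A * S" by (simp add: S_def sum_distrib_left)
  finally have "S \<le> card \<Omega> * (\<Sum>k\<in>{T<..n}. a k) + (s * A) * S"
    using s by (simp add: mult_left_mono mult.assoc)
  \<comment> \<open>The hypothesis on \<open>s\<close> lets half of \<open>S\<close> be absorbed on
    the left.\<close>
  moreover have "(s * A) * S \<le> (1 / 2) * S"
    using s H_nonneg by (intro mult_right_mono) (auto simp: A_def S_def intro!: sum_nonneg)
  ultimately have S: "S \<le> 2 * card \<Omega> * (\<Sum>k\<in>{T<..n}. a k)" by simp
  have ivl: "{T<..<Suc n} = {T<..n}" by auto
  have "(\<Sum>u\<in>\<Omega>. (1 + s) ^ card {k\<in>{T<..n}. X u k = Y k}) = (\<Sum>u\<in>\<Omega>. (1 + s) ^ C u (Suc n))"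
    by (simp only: C_def ivl)
  also have "\<dots> = card \<Omega> + s * S"
    unfolding S_def H_def telescope[of _ "Suc n"] ivl
    by (subst sum.swap) (simp only: sum.distrib sum_distrib_left[symmetric] sum_constant mult_1_right)
  also have "\<dots> \<le> card \<Omega> + s * (2 * card \<Omega> * (\<Sum>k\<in>{T<..n}. a k))"
    using S s by (intro add_left_mono mult_left_mono) auto
  finally show ?thesis by (simp add: algebra_simps)
qed

section \<open>A multiscale random path\<close>

lemma sum_PiE_resample:
  fixes F :: "('i \<Rightarrow> 'b) \<Rightarrow> real"
  assumes "B \<in> I"
  shows "(\<Sum>u\<in>Pi\<^sub>E I W. \<Sum>w\<in>W B. F (u(B := w))) = real (card (W B)) * (\<Sum>u\<in>Pi\<^sub>E I W. F u)"
proof -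
  have "(\<Sum>u\<in>Pi\<^sub>E I W. \<Sum>w\<in>W B. F (u(B := w))) = (\<Sum>(u, w)\<in>Pi\<^sub>E I W \<times> W B. F (u(B := w)))"
    by (rule sum.cartesian_product)
  \<comment> \<open>Exchanging the coordinate at \<open>B\<close> with the fresh value is an
    involution, so resampling one coordinate preserves the uniform distribution.\<close>
  also have "\<dots> = (\<Sum>(u, w)\<in>Pi\<^sub>E I W \<times> W B. F u)"
    by (rule sum.reindex_bij_witness[of _ "\<lambda>(u, w). (u(B := w), u B)" "\<lambda>(u, w). (u(B := w), u B)"])
      (use assms in \<open>auto simp: PiE_iff extensional_def\<close>)
  also have "\<dots> = (\<Sum>u\<in>Pi\<^sub>E I W. \<Sum>w\<in>W B. F u)"
    by (rule sum.cartesian_product[symmetric])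
  finally show ?thesis by (simp add: sum_distrib_left)
qed

text \<open>A time \<open>m\<close> has scale \<open>l = multiplicity 2 m\<close> and lies in the block of length \<open>8 ^ Suc l\<close> numbered
  \<open>i\<close>, where it has some rank \<open>r < 4 ^ Suc l\<close> among the times of scale \<open>l\<close>. All times of scale \<open>l\<close>
  in one block share the parameter \<open>u (l, i)\<close>, whose two components are the numbers of steps in
  the directions \<open>a\<close> and \<open>b\<close>. With \<open>u (l, i)\<close> uniform on a set of size of order \<open>16 ^ l\<close>, a block
  within the future spreads the position over that many sites, and \<open>16 > 8\<close> makes the bounds
  summable in time.\<close>

definition scale :: "nat \<Rightarrow> nat" where
  "scale m = multiplicity 2 m"

definition block :: "nat \<Rightarrow> nat \<times> nat" where
  "block m = (scale m, m div 8 ^ Suc (scale m))"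

definition block_rank :: "nat \<Rightarrow> nat" where
  "block_rank m = (m mod 8 ^ Suc (scale m)) div 2 ^ Suc (scale m)"

text \<open>Ranks below \<open>h\<close> are reserved for \<open>a\<close> and ranks from
  \<open>h\<close> on for \<open>b\<close>. As \<open>p\<close> and \<open>q\<close> stay below
  \<open>h\<close> and a block has \<open>2 * h\<close> ranks of its scale, the two windows never
  overlap; \<open>c\<close> fills the rest, so both counts vary independently.\<close>

definition step_dir :: "'d \<Rightarrow> 'd \<Rightarrow> 'd \<Rightarrow> (nat \<times> nat \<Rightarrow> nat \<times> nat) \<Rightarrow> nat \<Rightarrow> 'd" where
  "step_dir a b c u m =
     (let (p, q) = u (block m); h = 2 * 4 ^ scale m in
      if block_rank m < p then a else if h \<le> block_rank m \<and> block_rank m < h + q then b else c)"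

definition path_pos :: "'d \<Rightarrow> 'd \<Rightarrow> 'd \<Rightarrow> (nat \<times> nat \<Rightarrow> nat \<times> nat) \<Rightarrow> nat \<Rightarrow> int ^ 'd::finite" where
  "path_pos a b c u n = (\<Sum>m\<in>{1..n}. axis (step_dir a b c u m) 1)"

definition block_params :: "nat \<times> nat \<Rightarrow> (nat \<times> nat) set" where
  "block_params B = {..<2 * 4 ^ fst B} \<times> {..<2 * 4 ^ fst B}"

text \<open>The uniform choice is from a finite set, so that expectations are finite sums; the index
  bounds cover every block met up to time \<open>n\<close>.\<close>

definition path_params :: "nat \<Rightarrow> (nat \<times> nat \<Rightarrow> nat \<times> nat) set" where
  "path_params n = Pi\<^sub>E ({..n} \<times> {..n}) block_params"

lemma finite_path_params: "finite (path_params n)"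
  by (auto simp: path_params_def block_params_def intro!: finite_PiE)

lemma path_params_nonempty: "path_params n \<noteq> {}"
  by (auto simp: path_params_def block_params_def PiE_eq_empty_iff lessThan_empty_iff)

lemma card_block_params: "card (block_params (l, i)) = 4 * 16 ^ l"
  by (simp add: block_params_def power_mult_distrib[symmetric] card_cartesian_product)

lemma path_pos_Suc: "path_pos a b c u (Suc n) = path_pos a b c u n + axis (step_dir a b c u (Suc n)) 1"
  by (simp add: path_pos_def)

lemma level_path_pos: "level (path_pos a b c u n) = int n"
  by (induction n) (simp add: path_pos_def, simp add: path_pos_Suc)

lemma path_pos_component: "path_pos a b c u n $ x = int (card {m\<in>{1..n}. step_dir a b c u m = x})"
proof -
  have "axis y 1 $ x = (of_bool (y = x) :: int)" for y
    by (simp add: axis_def eq_commute)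
  then show ?thesis by (simp add: path_pos_def Int_def)
qed

text \<open>The times of scale \<open>l\<close> are the odd multiples of \<open>2 ^ l\<close>. As 8
  = 4 * 2, a block of length \<open>8 ^ Suc l\<close> contains \<open>4 ^ Suc l\<close> of them, one
  for each rank.\<close>

lemma scaled_time:
  fixes r l i :: nat
  assumes "r < 4 ^ Suc l"
  defines "m \<equiv> i * 8 ^ Suc l + r * 2 ^ Suc l + 2 ^ l"
  shows "scale m = l" "block m = (l, i)" "block_rank m = r"
    "0 < m" "i * 8 ^ Suc l \<le> m" "m < Suc i * 8 ^ Suc l"
proof -
  have "(8::nat) ^ Suc l = 2 ^ l * (8 * 4 ^ l)"
    by (simp add: power_mult_distrib[symmetric])
  then have "m = 2 ^ l * (2 * (4 * i * 4 ^ l + r) + 1)" by (simp add: m_def algebra_simps)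
  then show scale: "scale m = l" unfolding scale_def by (rule multiplicity_decomposeI) auto
  have "(8::nat) ^ Suc l = 4 ^ Suc l * 2 ^ Suc l" by (simp add: power_mult_distrib[symmetric])
  moreover have "(r + 1) * 2 ^ Suc l \<le> 4 ^ Suc l * 2 ^ Suc l"
    using assms(1) by (intro mult_right_mono) auto
  ultimately have less: "r * 2 ^ Suc l + 2 ^ l < (8::nat) ^ Suc l"
    by (simp add: algebra_simps) (use zero_less_power[of "2::nat" l] in linarith)
  have m: "m = (r * 2 ^ Suc l + 2 ^ l) + i * 8 ^ Suc l" by (simp add: m_def)
  have "m div 8 ^ Suc l = i" using less unfolding m by (subst div_mult_self1) auto
  then show "block m = (l, i)" by (simp add: block_def scale)
  have "m mod 8 ^ Suc l = 2 ^ l + r * 2 ^ Suc l" using less unfolding m by (subst mod_mult_self1) auto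
  moreover have "(2 ^ l + r * 2 ^ Suc l) div 2 ^ Suc l = r" by (subst div_mult_self1) auto
  ultimately show "block_rank m = r" by (simp add: block_rank_def scale)
  show "0 < m" by (simp add: m_def)
  show "i * 8 ^ Suc l \<le> m" by (simp add: m_def)
  show "m < Suc i * 8 ^ Suc l" using less by (simp add: m)
qed

text \<open>With the other blocks fixed, enlarging one component adds a time at which the path moves
  in its direction and removes none. So the coordinates \<open>a\<close> and \<open>b\<close> of the
  position determine the two components. The block has to end by time \<open>n\<close> for the added
  time to count.\<close>

lemma path_pos_param_inj:
  assumes abc: "a \<noteq> b" "a \<noteq> c" "b \<noteq> c"
    and same: "\<And>B. B \<noteq> (l, i) \<Longrightarrow> u B = u' B"
    and mem: "u (l, i) \<in> block_params (l, i)" "u' (l, i) \<in> block_params (l, i)"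
    and block: "0 < i" "Suc i * 8 ^ Suc l \<le> n"
    and eq: "path_pos a b c u n = path_pos a b c u' n"
  shows "u (l, i) = u' (l, i)"
proof -
  let ?B = "(l, i)"
  let ?h = "2 * 4 ^ l :: nat"
  have no_a: False
    if same: "\<And>B. B \<noteq> ?B \<Longrightarrow> u B = u' B" and mem: "u' ?B \<in> block_params ?B"
      and eq: "path_pos a b c u n = path_pos a b c u' n"
      and less: "fst (u ?B) < fst (u' ?B)" for u u' :: "nat \<times> nat \<Rightarrow> nat \<times> nat"
  proof -
    let ?D = "\<lambda>u. {m\<in>{1..n}. step_dir a b c u m = a}"
    let ?m = "i * 8 ^ Suc l + fst (u ?B) * 2 ^ Suc l + 2 ^ l"
    have iff: "step_dir a b c u m = a \<longleftrightarrow> block_rank m < fst (u (block m))" for u m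
      using abc by (auto simp: step_dir_def Let_def split: prod.splits)
    have "fst (u ?B) < 4 ^ Suc l" using less mem by (auto simp: block_params_def)
    note m = scaled_time[OF this, of i]
    have "?D u \<subseteq> ?D u'"
    proof
      fix m assume m: "m \<in> ?D u"
      show "m \<in> ?D u'"
      proof (cases "block m = ?B")
        case True
        with m less show ?thesis by (auto simp: iff)
      next
        case False
        with m same[OF False] show ?thesis by (auto simp: iff)
      qed
    qed
    moreover have "?m \<in> ?D u' - ?D u" using m block less by (auto simp: iff Suc_le_eq)
    ultimately have "?D u \<subset> ?D u'" by blast
    then have "card (?D u) < card (?D u')" by (intro psubset_card_mono) auto
    then show False using arg_cong[OF eq, of "\<lambda>x. x $ a"] by (simp add: path_pos_component)
  qed
  have no_b: False
    if same: "\<And>B. B \<noteq> ?B \<Longrightarrow> u B = u' B" and mem: "u ?B \<in> block_params ?B" "u' ?B \<in> block_params ?B"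
      and eq: "path_pos a b c u n = path_pos a b c u' n"
      and less: "snd (u ?B) < snd (u' ?B)" for u u' :: "nat \<times> nat \<Rightarrow> nat \<times> nat"
  proof -
    let ?D = "\<lambda>u. {m\<in>{1..n}. step_dir a b c u m = b}"
    let ?m = "i * 8 ^ Suc l + (?h + snd (u ?B)) * 2 ^ Suc l + 2 ^ l"
    \<comment> \<open>For parameters in range the condition on \<open>fst\<close> follows from the
      one after it; it is kept because only the parameter of \<open>?B\<close> is known to be in
      range.\<close>
    have iff: "step_dir a b c u m = b \<longleftrightarrow> fst (u (block m)) \<le> block_rank m \<and>
        2 * 4 ^ scale m \<le> block_rank m \<and> block_rank m < 2 * 4 ^ scale m + snd (u (block m))" for u m
      using abc by (auto simp: step_dir_def Let_def split: prod.splits)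
    have bounds: "fst (u ?B) < ?h" "fst (u' ?B) < ?h" "snd (u' ?B) < ?h"
      using mem by (auto simp: block_params_def)
    have "?h + snd (u ?B) < 4 ^ Suc l" using less bounds by simp
    note m = scaled_time[OF this, of i]
    have "?D u \<subseteq> ?D u'"
    proof
      fix m assume m: "m \<in> ?D u"
      show "m \<in> ?D u'"
      proof (cases "block m = ?B")
        case True
        then have "scale m = l" by (simp add: block_def)
        with m True bounds less show ?thesis by (auto simp: iff)
      next
        case False
        with m same[OF False] show ?thesis by (auto simp: iff)
      qed
    qed
    moreover have "?m \<in> ?D u' - ?D u" using m block less bounds by (auto simp: iff Suc_le_eq)
    ultimately have "?D u \<subset> ?D u'" by blast
    then have "card (?D u) < card (?D u')" by (intro psubset_card_mono) auto
    then show False using arg_cong[OF eq, of "\<lambda>x. x $ b"] by (simp add: path_pos_component)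
  qed
  have "fst (u ?B) = fst (u' ?B)"
  proof (rule linorder_cases)
    assume "fst (u ?B) < fst (u' ?B)"
    then show ?thesis using no_a[OF same mem(2) eq] by blast
  next
    assume "fst (u' ?B) < fst (u ?B)"
    then show ?thesis using no_a[OF same[symmetric] mem(1) eq[symmetric]] by blast
  qed
  moreover have "snd (u ?B) = snd (u' ?B)"
  proof (rule linorder_cases)
    assume "snd (u ?B) < snd (u' ?B)"
    then show ?thesis using no_b[OF same mem eq] by blast
  next
    assume "snd (u' ?B) < snd (u ?B)"
    then show ?thesis using no_b[OF same[symmetric] mem(2,1) eq[symmetric]] by blast
  qed
  ultimately show ?thesis by (rule prod_eqI)
qed

lemma path_pos_past:
  assumes "k < i * 8 ^ Suc l"
  shows "path_pos a b c (u((l, i) := w)) k = path_pos a b c u k"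
proof -
  have "block m \<noteq> (l, i)" if "m \<le> k" for m
  proof
    assume "block m = (l, i)"
    then have "i = m div 8 ^ Suc l" by (auto simp: block_def)
    then have "i * 8 ^ Suc l \<le> m" by (simp add: div_times_less_eq_dividend del: power_Suc)
    with that assms show False by simp
  qed
  then show ?thesis
    unfolding path_pos_def by (intro sum.cong refl arg_cong2[where f=axis]) (auto simp: step_dir_def)
qed

text \<open>Between \<open>j\<close> and \<open>k\<close> lies a whole block of length comparable
  with \<open>k - j\<close>. Its parameter does not affect the past, and at most one of its
  \<open>4 * 16 ^ l\<close> values leads to \<open>y\<close> at time \<open>k\<close>. Since 16 =
  8^(4/3), resampling it gives the bound; 128 is the worst ratio of \<open>k - j\<close> to
  \<open>8 ^ l\<close>.\<close>

lemma path_pos_unpredictable: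
  fixes g :: "(nat \<times> nat \<Rightarrow> nat \<times> nat) \<Rightarrow> real"
  assumes abc: "a \<noteq> b" "a \<noteq> c" "b \<noteq> c"
    and jk: "j < k" "k \<le> n" and g: "\<And>u. 0 \<le> g u"
    and past: "\<And>u u'. \<lbrakk>u \<in> path_params n; u' \<in> path_params n;
      \<forall>i\<le>j. path_pos a b c u i = path_pos a b c u' i\<rbrakk> \<Longrightarrow> g u = g u'"
  shows "(\<Sum>u\<in>path_params n. of_bool (path_pos a b c u k = y) * g u)
    \<le> (128 / real (k - j)) powr (4 / 3) * (\<Sum>u\<in>path_params n. g u)"
proof (cases "k - j < 16")
  \<comment> \<open>Twice the smallest block length, 8, does not fit here, but the factor is at
    least 1 and the bound trivial.\<close>
  case True
  have "1 powr (4/3) \<le> (128 / real (k - j)) powr (4 / 3)"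
    by (rule powr_mono2) (use True jk in \<open>auto simp: field_simps\<close>)
  then have "(\<Sum>u\<in>path_params n. g u) * 1 \<le> (\<Sum>u\<in>path_params n. g u) * (128 / real (k - j)) powr (4 / 3)"
    by (intro mult_left_mono sum_nonneg g) auto
  moreover have "(\<Sum>u\<in>path_params n. of_bool (path_pos a b c u k = y) * g u) \<le> (\<Sum>u\<in>path_params n. g u)"
    by (intro sum_mono) (use g in auto)
  ultimately show ?thesis by (simp add: mult.commute)
next
  case False
  then have "1 \<le> (k - j) div 2" by linarith
  then obtain l' where l': "8 ^ l' \<le> (k - j) div 2" "(k - j) div 2 < 8 ^ (l' + 1)"
    using ex_power_ivl1[of 8 "(k - j) div 2"] by auto
  then have "l' \<noteq> 0" using False by (intro notI) simp
  then obtain l where "l' = Suc l" by (cases l') auto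
  with l' have l: "2 * 8 ^ Suc l \<le> k - j" "k - j < 128 * 8 ^ l" by simp_all
  \<comment> \<open>The first block of scale \<open>l\<close> that starts after \<open>j\<close>.
    Reserving twice its length guarantees that it ends by time \<open>k\<close>.\<close>
  define i where "i = Suc (j div 8 ^ Suc l)"
  have i: "0 < i" "j < i * 8 ^ Suc l" "Suc i * 8 ^ Suc l \<le> k"
  proof -
    show "j < i * 8 ^ Suc l"
      using dividend_less_times_div[of "8 ^ Suc l" j] by (simp add: i_def mult.commute)
    have "Suc i * 8 ^ Suc l = (j div 8 ^ Suc l) * 8 ^ Suc l + 2 * 8 ^ Suc l" by (simp add: i_def)
    also have "\<dots> \<le> j + (k - j)" by (intro add_mono l div_times_less_eq_dividend)
    finally show "Suc i * 8 ^ Suc l \<le> k" using jk by simp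
  qed (simp add: i_def)
  let ?B = "(l, i)" and ?X = "path_pos a b c"
  have "l < 8 ^ Suc l" using less_exp[of l] power_mono[of 2 "8::nat" l] power_increasing[of l "Suc l" "8::nat"] by linarith
  moreover have "8 ^ Suc l \<le> k" using i(3) by simp
  moreover have "i \<le> k"
  proof -
    have "i * 1 \<le> Suc i * 8 ^ Suc l" by (intro mult_le_mono) auto
    with i(3) show ?thesis by simp
  qed
  ultimately have B: "?B \<in> {..n} \<times> {..n}" using jk by auto
  have upd: "u(?B := w) \<in> path_params n" if "u \<in> path_params n" "w \<in> block_params ?B" for u w
    using that B unfolding path_params_def by (auto simp: PiE_iff extensional_def)
  have "card (block_params ?B) * (\<Sum>u\<in>path_params n. of_bool (?X u k = y) * g u)
      = (\<Sum>u\<in>path_params n. \<Sum>w\<in>block_params ?B. of_bool (?X (u(?B := w)) k = y) * g (u(?B := w)))"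
    unfolding path_params_def by (rule sum_PiE_resample[OF B, symmetric])
  also have "\<dots> = (\<Sum>u\<in>path_params n. \<Sum>w\<in>block_params ?B. of_bool (?X (u(?B := w)) k = y) * g u)"
  proof (intro sum.cong refl arg_cong2[where f=times] past upd)
    fix u and w :: "nat \<times> nat"
    show "\<forall>m\<le>j. ?X (u(?B := w)) m = ?X u m"
      using i(2) by (auto intro: path_pos_past)
  qed
  also have "\<dots> \<le> (\<Sum>u\<in>path_params n. g u)"
  proof (rule sum_mono)
    fix u assume "u \<in> path_params n"
    let ?W = "{w\<in>block_params ?B. ?X (u(?B := w)) k = y}"
    have "w = w'" if "w \<in> ?W" "w' \<in> ?W" for w w'
      using path_pos_param_inj[of a b c l i "u(?B := w)" "u(?B := w')" k] abc i that by auto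
    then have "card ?W \<le> 1" by (auto intro!: card_le_Suc0_iff_eq[THEN iffD2] simp: block_params_def)
    moreover have "(\<Sum>w\<in>block_params ?B. of_bool (?X (u(?B := w)) k = y) * g u) = card ?W * g u"
      by (simp add: sum_distrib_right[symmetric] Int_def block_params_def)
    ultimately show "(\<Sum>w\<in>block_params ?B. of_bool (?X (u(?B := w)) k = y) * g u) \<le> g u"
      using mult_right_mono[of "real (card ?W)" 1 "g u"] g by simp
  qed
  finally have le: "4 * 16 ^ l * (\<Sum>u\<in>path_params n. of_bool (?X u k = y) * g u) \<le> (\<Sum>u\<in>path_params n. g u)"
    by (simp add: card_block_params)
  have "(real (k - j) / 128) powr (4/3) \<le> (8 ^ l) powr (4/3)"
  proof (rule powr_mono2)
    have "real (k - j) < real (128 * 8 ^ l)" using l(2) by (simp only: of_nat_less_iff)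
    then show "real (k - j) / 128 \<le> 8 ^ l" by (simp del: of_nat_diff)
  qed auto
  also have "(8 ^ l) powr (4/3) = (16::real) ^ l"
  proof -
    have "(8::real) powr (4/3) = (2 powr 3) powr (4/3)" by simp
    also have "\<dots> = 16" by (simp only: powr_powr) simp
    finally have "(8::real) powr (4/3) = 16" .
    then have "(8 powr real l) powr (4/3) = (16::real) powr real l"
      by (metis powr_powr mult.commute)
    then show ?thesis by (simp add: powr_realpow)
  qed
  also have "\<dots> \<le> 4 * 16 ^ l" by simp
  finally have "(real (k - j) / 128) powr (4/3) * (\<Sum>u\<in>path_params n. of_bool (?X u k = y) * g u)
      \<le> 4 * 16 ^ l * (\<Sum>u\<in>path_params n. of_bool (?X u k = y) * g u)"
    by (intro mult_right_mono sum_nonneg) (use g in auto)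
  with le have "(real (k - j) / 128) powr (4/3) * (\<Sum>u\<in>path_params n. of_bool (?X u k = y) * g u)
      \<le> (\<Sum>u\<in>path_params n. g u)" by linarith
  then have "(128 / real (k - j)) powr (4 / 3) * ((real (k - j) / 128) powr (4/3) *
      (\<Sum>u\<in>path_params n. of_bool (?X u k = y) * g u)) \<le> (128 / real (k - j)) powr (4 / 3) * (\<Sum>u\<in>path_params n. g u)"
    by (rule mult_left_mono) simp
  moreover have "(128 / real (k - j)) powr (4 / 3) * (real (k - j) / 128) powr (4/3) = 1"
  proof -
    have "0 < real (k - j)" using jk by simp
    then have "128 / real (k - j) * (real (k - j) / 128) = 1" by (simp del: of_nat_diff)
    then show ?thesis by (metis powr_mult powr_one_eq_one)
  qed
  ultimately show ?thesis by (simp only: mult.assoc[symmetric] mult_1_left)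
qed

section \<open>The second moment method\<close>

text \<open>Markov's inequality is applied twice, to the squared deviation of \<open>Z\<close> from
  1 and to \<open>En\<close>, at a cost of at most \<open>\<epsilon> / 2\<close> each. The moment
  has base \<open>x\<^sup>2\<close> because this one bound controls both \<open>x ^ N u u'\<close>
  and, by Bernoulli's inequality, \<open>N u u' * x ^ N u u'\<close>.\<close>

lemma (in prob_space) second_moment_events:
  fixes A :: "'u \<Rightarrow> 'a set" and N :: "'u \<Rightarrow> 'u \<Rightarrow> nat" and q x \<epsilon> \<delta> :: real
  assumes fin: "finite \<Omega>" "\<Omega> \<noteq> {}" and A [measurable]: "\<And>u. u \<in> \<Omega> \<Longrightarrow> A u \<in> events"
    and q: "0 < q" and x: "1 < x"
    and one: "\<And>u. u \<in> \<Omega> \<Longrightarrow> prob (A u) = q"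
    and two: "\<And>u u'. \<lbrakk>u \<in> \<Omega>; u' \<in> \<Omega>\<rbrakk> \<Longrightarrow> prob (A u \<inter> A u') = q\<^sup>2 * x ^ N u u'"
    and moment: "(\<Sum>u\<in>\<Omega>. \<Sum>u'\<in>\<Omega>. (x\<^sup>2) ^ N u u') \<le> (real (card \<Omega>))\<^sup>2 * (1 + \<delta>)"
    and \<epsilon>: "0 < \<epsilon>" "8 * \<delta> \<le> \<epsilon>" "\<delta> \<le> 1"
  defines "Z \<equiv> \<lambda>\<omega>. (\<Sum>u\<in>\<Omega>. indicator (A u) \<omega> :: real) / (card \<Omega> * q)"
    and "En \<equiv> \<lambda>\<omega>. (\<Sum>u\<in>\<Omega>. \<Sum>u'\<in>\<Omega>. real (N u u') * indicator (A u \<inter> A u') \<omega>) / (card \<Omega> * q)\<^sup>2"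
  shows "{\<omega>\<in>space M. 1 / 2 \<le> Z \<omega> \<and> En \<omega> \<le> 4 / ((x - 1) * \<epsilon>)} \<in> events"
    and "1 - \<epsilon> \<le> prob {\<omega>\<in>space M. 1 / 2 \<le> Z \<omega> \<and> En \<omega> \<le> 4 / ((x - 1) * \<epsilon>)}"
proof -
  let ?c = "real (card \<Omega>)"
  define K where "K = 4 / ((x - 1) * \<epsilon>)"
  have c: "0 < ?c" using fin by (simp add: card_gt_0_iff)
  have K: "0 < K" using x \<epsilon> by (simp add: K_def)
  have meas [measurable]: "Z \<in> borel_measurable M" "En \<in> borel_measurable M"
    unfolding Z_def En_def
    by (auto intro!: borel_measurable_divide borel_measurable_sum borel_measurable_times borel_measurable_indicator)
  show "{\<omega>\<in>space M. 1 / 2 \<le> Z \<omega> \<and> En \<omega> \<le> 4 / ((x - 1) * \<epsilon>)} \<in> events" by measurable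
  have int1: "integrable M (\<lambda>\<omega>. indicator (A u) \<omega> :: real)" if "u \<in> \<Omega>" for u
    using that by (simp add: integrable_indicator_iff less_top[symmetric])
  have int2: "integrable M (\<lambda>\<omega>. indicator (A u \<inter> A u') \<omega> :: real)" if "u \<in> \<Omega>" "u' \<in> \<Omega>" for u u'
    using that by (simp add: integrable_indicator_iff less_top[symmetric])
  have intZ: "integrable M Z" unfolding Z_def by (intro integrable_divide Bochner_Integration.integrable_sum int1)
  have intEn: "integrable M En" unfolding En_def
    by (intro integrable_divide Bochner_Integration.integrable_sum integrable_mult_right int2)
  have expZ: "expectation Z = 1"
    unfolding Z_def using c q fin
    by (simp add: Bochner_Integration.integral_sum int1 one sets.sets_into_space Int_absorb2)
  have Z2: "(Z \<omega>)\<^sup>2 = (\<Sum>u\<in>\<Omega>. \<Sum>u'\<in>\<Omega>. indicator (A u \<inter> A u') \<omega>) / (?c * q)\<^sup>2" for \<omega>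
    by (simp add: Z_def power_divide power2_eq_square sum_product indicator_inter_arith)
  have intZ2: "integrable M (\<lambda>\<omega>. (Z \<omega>)\<^sup>2)"
    unfolding Z2 by (intro integrable_divide Bochner_Integration.integrable_sum int2)
  have "expectation (\<lambda>\<omega>. (Z \<omega>)\<^sup>2) = (\<Sum>u\<in>\<Omega>. \<Sum>u'\<in>\<Omega>. q\<^sup>2 * x ^ N u u') / (?c * q)\<^sup>2"
    unfolding Z2
    by (simp add: Bochner_Integration.integral_sum Bochner_Integration.integrable_sum int2 two sets.sets_into_space Int_absorb2)
  also have "\<dots> = (\<Sum>u\<in>\<Omega>. \<Sum>u'\<in>\<Omega>. x ^ N u u') / ?c\<^sup>2"
    using q by (simp add: sum_distrib_left[symmetric] power_mult_distrib)
  also have "\<dots> \<le> (\<Sum>u\<in>\<Omega>. \<Sum>u'\<in>\<Omega>. (x\<^sup>2) ^ N u u') / ?c\<^sup>2"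
    by (intro divide_right_mono sum_mono power_mono) (use x in \<open>auto simp: power2_eq_square\<close>)
  also have "\<dots> \<le> 1 + \<delta>" using moment c by (simp add: field_simps)
  finally have expZ2: "expectation (\<lambda>\<omega>. (Z \<omega>)\<^sup>2) \<le> 1 + \<delta>" .
  have intV: "integrable M (\<lambda>\<omega>. (Z \<omega> - 1)\<^sup>2)"
    unfolding power2_diff by (auto intro!: intZ2 intZ)
  have "expectation (\<lambda>\<omega>. (Z \<omega> - 1)\<^sup>2) = expectation (\<lambda>\<omega>. (Z \<omega>)\<^sup>2) - 1"
    unfolding power2_diff using intZ intZ2 expZ by (simp add: prob_space)
  then have V: "expectation (\<lambda>\<omega>. (Z \<omega> - 1)\<^sup>2) \<le> \<delta>" using expZ2 by simp
  \<comment> \<open>A value of \<open>Z\<close> below 1/2 forces a squared deviation above 1/4, and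
    \<open>8 * \<delta> \<le> \<epsilon>\<close> turns the resulting \<open>4 * \<delta>\<close>
    into at most \<open>\<epsilon> / 2\<close>.\<close>
  have "prob {\<omega>\<in>space M. 1 / 4 \<le> (Z \<omega> - 1)\<^sup>2} \<le> expectation (\<lambda>\<omega>. (Z \<omega> - 1)\<^sup>2) / (1 / 4)"
    by (rule integral_Markov_inequality_measure[OF intV sets.empty_sets]) auto
  with V \<epsilon>(2) have badZ: "prob {\<omega>\<in>space M. 1 / 4 \<le> (Z \<omega> - 1)\<^sup>2} \<le> \<epsilon> / 2" by simp
  have bern: "real n * x ^ n \<le> (x\<^sup>2) ^ n / (x - 1)" for n
  proof -
    have "real n * (x - 1) \<le> x ^ n"
      using Bernoulli_inequality[of "x - 1" n] x by simp
    then have "real n * (x - 1) * x ^ n \<le> x ^ n * x ^ n"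
      using x by (intro mult_right_mono) auto
    then show ?thesis using x by (simp add: field_simps power_mult_distrib power2_eq_square)
  qed
  have "expectation En = (\<Sum>u\<in>\<Omega>. \<Sum>u'\<in>\<Omega>. real (N u u') * (q\<^sup>2 * x ^ N u u')) / (?c * q)\<^sup>2"
    unfolding En_def
    by (simp add: Bochner_Integration.integral_sum Bochner_Integration.integrable_sum int2 two sets.sets_into_space Int_absorb2)
  also have "\<dots> = (\<Sum>u\<in>\<Omega>. \<Sum>u'\<in>\<Omega>. real (N u u') * x ^ N u u') / ?c\<^sup>2"
    using q by (simp only: mult.left_commute[of _ "q\<^sup>2"] sum_distrib_left[symmetric] power_mult_distrib) simp
  also have "\<dots> \<le> (\<Sum>u\<in>\<Omega>. \<Sum>u'\<in>\<Omega>. (x\<^sup>2) ^ N u u' / (x - 1)) / ?c\<^sup>2"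
    by (intro divide_right_mono sum_mono bern) auto
  also have "\<dots> = (\<Sum>u\<in>\<Omega>. \<Sum>u'\<in>\<Omega>. (x\<^sup>2) ^ N u u') / (?c\<^sup>2 * (x - 1))"
    by (simp add: sum_divide_distrib mult.commute)
  also have "\<dots> \<le> (?c\<^sup>2 * (1 + \<delta>)) / (?c\<^sup>2 * (x - 1))"
    using moment x by (intro divide_right_mono) auto
  also have "\<dots> = (1 + \<delta>) / (x - 1)" using c by simp
  also have "\<dots> \<le> 2 / (x - 1)" using x \<epsilon> by (intro divide_right_mono) auto
  finally have expEn: "expectation En \<le> 2 / (x - 1)" .
  have "prob {\<omega>\<in>space M. K \<le> En \<omega>} \<le> expectation En / K"
    by (rule integral_Markov_inequality_measure[OF intEn sets.empty_sets])
      (use K in \<open>auto simp: En_def intro!: sum_nonneg divide_nonneg_nonneg\<close>)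
  also have "\<dots> \<le> (2 / (x - 1)) / K" using expEn K by (intro divide_right_mono) auto
  also have "\<dots> = \<epsilon> / 2" using x \<epsilon> by (simp add: K_def)
  finally have badEn: "prob {\<omega>\<in>space M. K \<le> En \<omega>} \<le> \<epsilon> / 2" .
  let ?G = "{\<omega>\<in>space M. 1 / 2 \<le> Z \<omega> \<and> En \<omega> \<le> K}"
  have "1 - prob ?G = prob (space M - ?G)" by (subst prob_compl) auto
  also have "\<dots> \<le> prob ({\<omega>\<in>space M. 1 / 4 \<le> (Z \<omega> - 1)\<^sup>2} \<union> {\<omega>\<in>space M. K \<le> En \<omega>})"
  proof (intro finite_measure_mono)
    have "1 / 4 \<le> (z - 1)\<^sup>2" if "\<not> 1 / 2 \<le> z" for z :: real
    proof -
      have "(1 / 2)\<^sup>2 \<le> (1 - z)\<^sup>2" using that by (intro power_mono) auto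
      then show ?thesis by (simp add: power2_commute[of z] power_divide)
    qed
    then show "space M - ?G \<subseteq> {\<omega>\<in>space M. 1 / 4 \<le> (Z \<omega> - 1)\<^sup>2} \<union> {\<omega>\<in>space M. K \<le> En \<omega>}"
      by (auto simp: not_le intro: less_imp_le)
  qed measurable
  also have "\<dots> \<le> prob {\<omega>\<in>space M. 1 / 4 \<le> (Z \<omega> - 1)\<^sup>2} + prob {\<omega>\<in>space M. K \<le> En \<omega>}"
    by (intro measure_Un_le) measurable
  also have "\<dots> \<le> \<epsilon>" using badZ badEn by simp
  finally show "1 - \<epsilon> \<le> prob {\<omega>\<in>space M. 1 / 2 \<le> Z \<omega> \<and> En \<omega> \<le> 4 / ((x - 1) * \<epsilon>)}"
    by (simp add: K_def)
qed

text \<open>Continuity from above along the decreasing unions. The good events for different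
  \<open>n\<close> are not nested, so their occurring infinitely often takes the place of a limit
  event.\<close>

lemma (in prob_space) prob_infinitely_often_ge:
  fixes G :: "nat \<Rightarrow> 'a set"
  assumes "\<And>n. G n \<in> events" "\<And>n. n0 \<le> n \<Longrightarrow> r \<le> prob (G n)"
  shows "(\<Inter>m. \<Union>n\<in>{m..}. G n) \<in> events" "r \<le> prob (\<Inter>m. \<Union>n\<in>{m..}. G n)"
proof -
  have U: "(\<Union>n\<in>{m..}. G n) \<in> events" for m using assms(1) by blast
  then show "(\<Inter>m. \<Union>n\<in>{m..}. G n) \<in> events" by blast
  have "(\<lambda>m. prob (\<Union>n\<in>{m..}. G n)) \<longlonglongrightarrow> prob (\<Inter>m. \<Union>n\<in>{m..}. G n)"
    by (rule finite_Lim_measure_decseq) (use U in \<open>auto simp only: decseq_def intro!: UN_mono\<close>, auto)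
  moreover have "r \<le> prob (\<Union>n\<in>{m..}. G n)" for m
  proof -
    have "r \<le> prob (G (max m n0))" by (rule assms(2)) simp
    also have "\<dots> \<le> prob (\<Union>n\<in>{m..}. G n)" by (intro finite_measure_mono U UN_upper) simp
    finally show ?thesis .
  qed
  ultimately show "r \<le> prob (\<Inter>m. \<Union>n\<in>{m..}. G n)"
    by (intro LIMSEQ_le_const[where a=r]) auto
qed

text \<open>Double counting. With the multiplicity as flow strength, the first identity evaluates
  the pairing path by path, and the second expresses the energy by the edges shared by pairs of
  paths.\<close>

lemma sum_edge_multiplicity:
  fixes \<phi> :: "'e \<Rightarrow> real"
  assumes fin: "finite U" "\<And>u. u \<in> U \<Longrightarrow> finite (A u)"
  shows "(\<Sum>e\<in>(\<Union>u\<in>U. A u). card {u\<in>U. e \<in> A u} * \<phi> e) = (\<Sum>u\<in>U. \<Sum>e\<in>A u. \<phi> e)"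
    and "(\<Sum>e\<in>(\<Union>u\<in>U. A u). (real (card {u\<in>U. e \<in> A u}))\<^sup>2) = (\<Sum>u\<in>U. \<Sum>u'\<in>U. card (A u \<inter> A u'))"
proof -
  let ?F = "\<Union>u\<in>U. A u"
  have F: "finite ?F" using fin by blast
  have *: "(\<Sum>e\<in>?F. card {u\<in>U. e \<in> A u} * \<phi> e) = (\<Sum>u\<in>U. \<Sum>e\<in>A u. \<phi> e)" for \<phi> :: "'e \<Rightarrow> real"
  proof -
    have "(\<Sum>e\<in>?F. card {u\<in>U. e \<in> A u} * \<phi> e) = (\<Sum>e\<in>?F. \<Sum>u\<in>{u\<in>U. e \<in> A u}. \<phi> e)" by simp
    also have "\<dots> = (\<Sum>u\<in>U. \<Sum>e\<in>{e\<in>?F. e \<in> A u}. \<phi> e)" by (rule sum.swap_restrict[OF F fin(1)])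
    also have "\<dots> = (\<Sum>u\<in>U. \<Sum>e\<in>A u. \<phi> e)" by (intro sum.cong refl) auto
    finally show ?thesis .
  qed
  then show "(\<Sum>e\<in>?F. card {u\<in>U. e \<in> A u} * \<phi> e) = (\<Sum>u\<in>U. \<Sum>e\<in>A u. \<phi> e)" .
  have "(\<Sum>e\<in>?F. (real (card {u\<in>U. e \<in> A u}))\<^sup>2) = (\<Sum>u\<in>U. \<Sum>e\<in>A u. real (card {u'\<in>U. e \<in> A u'}))"
    unfolding *[symmetric] by (simp add: power2_eq_square)
  also have "\<dots> = (\<Sum>u\<in>U. \<Sum>u'\<in>U. real (card (A u \<inter> A u')))"
  proof (rule sum.cong[OF refl])
    fix u assume u: "u \<in> U"
    have "(\<Sum>e\<in>A u. real (card {u'\<in>U. e \<in> A u'})) = (\<Sum>e\<in>A u. \<Sum>u'\<in>{u'\<in>U. e \<in> A u'}. 1)" by simp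
    also have "\<dots> = (\<Sum>u'\<in>U. \<Sum>e\<in>{e\<in>A u. e \<in> A u'}. 1)" by (rule sum.swap_restrict[OF fin(2)[OF u] fin(1)])
    finally show "(\<Sum>e\<in>A u. real (card {u'\<in>U. e \<in> A u'})) = (\<Sum>u'\<in>U. real (card (A u \<inter> A u')))"
      by (simp add: Int_def)
  qed
  finally show "(\<Sum>e\<in>?F. (real (card {u\<in>U. e \<in> A u}))\<^sup>2) = (\<Sum>u\<in>U. \<Sum>u'\<in>U. card (A u \<inter> A u'))"
    by simp
qed

section \<open>Open paths in oriented percolation\<close>

lemma oriented_percolation_all_open:
  fixes F :: "((int ^ 'd::finite) \<times> (int ^ 'd)) set"
  assumes F: "finite F" "F \<subseteq> parcs Zd_digraph" and p: "0 \<le> p" "p \<le> 1"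
  shows "{\<omega>\<in>space (oriented_percolation p). \<forall>e\<in>F. \<omega> e} \<in> sets (oriented_percolation p)"
    and "measure (oriented_percolation p) {\<omega>\<in>space (oriented_percolation p). \<forall>e\<in>F. \<omega> e} = p ^ card F"
proof -
  let ?B = "\<lambda>e :: (int ^ 'd) \<times> (int ^ 'd). measure_pmf (bernoulli_pmf p)"
  interpret product_prob_space ?B "parcs Zd_digraph"
    by (intro product_prob_spaceI prob_space_measure_pmf)
  have eq: "{\<omega>\<in>space (oriented_percolation p). \<forall>e\<in>F. \<omega> e}
      = prod_emb (parcs Zd_digraph) ?B F (Pi\<^sub>E F (\<lambda>_. {True}))"
  proof -
    have "{\<omega>\<in>space (Pi\<^sub>M (parcs Zd_digraph) ?B). \<forall>e\<in>F. \<omega> e \<in> Y e}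
        = prod_emb (parcs Zd_digraph) ?B F (Pi\<^sub>E F Y)" for Y
      unfolding prod_emb_def using F(2) by (auto simp: space_PiM Pi_iff)
    from this[of "\<lambda>_. {True}"] show ?thesis by (simp add: oriented_percolation_def)
  qed
  show "{\<omega>\<in>space (oriented_percolation p). \<forall>e\<in>F. \<omega> e} \<in> sets (oriented_percolation p)"
    unfolding eq unfolding oriented_percolation_def
    by (intro sets_PiM_I F) simp_all
  show "measure (oriented_percolation p) {\<omega>\<in>space (oriented_percolation p). \<forall>e\<in>F. \<omega> e} = p ^ card F"
    unfolding eq unfolding oriented_percolation_def
    using F p by (subst measure_PiM_emb) (simp_all add: measure_pmf_single)
qed

definition path_edges ::
  "'d \<Rightarrow> 'd \<Rightarrow> 'd \<Rightarrow> nat \<Rightarrow> nat \<Rightarrow> (nat \<times> nat \<Rightarrow> nat \<times> nat) \<Rightarrow> ((int ^ 'd::finite) \<times> (int ^ 'd)) set" where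
  "path_edges a b c T n u = (\<lambda>k. (path_pos a b c u k, path_pos a b c u (Suc k))) ` {T..<n}"

lemma finite_path_edges: "finite (path_edges a b c T n u)"
  by (simp add: path_edges_def)

text \<open>The level records the time, so two paths can meet only at equal times.\<close>

lemma path_pos_eq_imp_eq:
  "path_pos a b c u k = path_pos a b c u' k' \<Longrightarrow> k = k'"
  using level_path_pos[of a b c u k] level_path_pos[of a b c u' k'] by simp

lemma inj_on_path_edge: "inj_on (\<lambda>k. (path_pos a b c u k, path_pos a b c u (Suc k))) K"
  by (auto simp: inj_on_def dest: path_pos_eq_imp_eq)

lemma card_path_edges: "card (path_edges a b c T n u) = n - T"
  unfolding path_edges_def by (subst card_image[OF inj_on_path_edge]) simp

lemma path_edges_subset: "path_edges a b c T n u \<subseteq> parcs Zd_digraph"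
  by (auto simp: path_edges_def path_pos_Suc Zd_arcs_iff)

text \<open>A common edge is charged to its endpoint, hence the range \<open>{T<..n}\<close>. A
  coincidence at time \<open>T\<close> itself is not counted, even for paths that leave level
  \<open>T\<close> from the same vertex.\<close>

lemma card_path_edges_Int_le:
  "card (path_edges a b c T n u \<inter> path_edges a b c T n u')
    \<le> card {k\<in>{T<..n}. path_pos a b c u k = path_pos a b c u' k}"
proof (rule surj_card_le)
  show "path_edges a b c T n u \<inter> path_edges a b c T n u' \<subseteq>
      (\<lambda>k. (path_pos a b c u (k - 1), path_pos a b c u k)) ` {k\<in>{T<..n}. path_pos a b c u k = path_pos a b c u' k}"
  proof
    fix e assume "e \<in> path_edges a b c T n u \<inter> path_edges a b c T n u'"
    then obtain k k' where k: "k \<in> {T..<n}" "e = (path_pos a b c u k, path_pos a b c u (Suc k))"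
      and k': "e = (path_pos a b c u' k', path_pos a b c u' (Suc k'))"
      by (auto simp: path_edges_def)
    then have "k = k'" using path_pos_eq_imp_eq[of a b c u k u' k'] by simp
    with k k' show "e \<in> (\<lambda>k. (path_pos a b c u (k - 1), path_pos a b c u k)) `
        {k\<in>{T<..n}. path_pos a b c u k = path_pos a b c u' k}"
      by (intro image_eqI[of _ _ "Suc k"]) auto
  qed
qed simp

text \<open>The open paths through \<open>v\<close> at time \<open>T\<close>, each with weight \<open>\<beta> n\<close>, form a flow from \<open>v\<close> to
  level \<open>n\<close>.\<close>

lemma transient_oriented_cluster_if_paths:
  fixes a b c :: "'d::finite" and v :: "int ^ 'd" and T :: nat and \<omega> and \<beta> :: "nat \<Rightarrow> real" and r K :: real
  defines "U \<equiv> \<lambda>n. {u \<in> path_params n. path_pos a b c u T = v \<and> (\<forall>e\<in>path_edges a b c T n u. \<omega> e)}"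
  assumes "0 < r" and \<beta>: "\<And>n. 0 \<le> \<beta> n" and freq: "\<exists>\<^sub>F n in sequentially. r \<le> \<beta> n * card (U n) \<and>
      (\<beta> n)\<^sup>2 * (\<Sum>u\<in>U n. \<Sum>u'\<in>U n. card (path_edges a b c T n u \<inter> path_edges a b c T n u')) \<le> K"
  shows "transient_graph (oriented_cluster \<omega> v)"
proof (rule transient_graph_oriented_cluster[OF \<open>0 < r\<close>])
  let ?O = "parcs (open_digraph \<omega>)" and ?X = "path_pos a b c" and ?E = "path_edges a b c T"
  fix h :: "int ^ 'd \<Rightarrow> real" assume fin: "finite {y. h y \<noteq> 0}"
  show "\<exists>F \<theta>. finite F \<and> F \<subseteq> parcs (oriented_cluster \<omega> v) \<and> (\<Sum>e\<in>F. (\<theta> e)\<^sup>2) \<le> K \<and>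
      r * h v \<le> (\<Sum>(y, z)\<in>F. \<theta> (y, z) * (h y - h z))"
  proof -
    \<comment> \<open>Finite support bounds the level up to which \<open>h\<close> is nonzero. An
      admissible \<open>n\<close> beyond it makes \<open>h\<close> vanish at the ends of the paths,
      which is why such \<open>n\<close> must occur infinitely often.\<close>
    have "finite (level ` {y. h y \<noteq> 0})" using fin by simp
    then obtain l where l: "\<And>y. h y \<noteq> 0 \<Longrightarrow> level y \<le> l"
      using bdd_above_finite[of "level ` {y. h y \<noteq> 0}"] by (auto simp: bdd_above_def)
    obtain n where n: "max T (nat (l + 1)) \<le> n" and r: "r \<le> \<beta> n * card (U n)"
      and K: "(\<beta> n)\<^sup>2 * (\<Sum>u\<in>U n. \<Sum>u'\<in>U n. card (?E n u \<inter> ?E n u')) \<le> K"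
      using freq unfolding frequently_sequentially by blast
    have Tn: "T \<le> n" and ln: "l < int n" using n by auto
    have finU: "finite (U n)" using finite_path_params[of n] by (simp add: U_def)
    define F where "F = (\<Union>u\<in>U n. ?E n u)"
    define \<theta> where "\<theta> e = \<beta> n * card {u\<in>U n. e \<in> ?E n u}" for e
    note mult = sum_edge_multiplicity[of "U n" "?E n", OF finU finite_path_edges, folded F_def]
    have reach: "(v, ?X u k) \<in> ?O\<^sup>*" if u: "u \<in> U n" and k: "T \<le> k" "k \<le> n" for u k
      using k
    proof (induction k rule: dec_induct)
      case base
      then show ?case using u by (simp add: U_def)
    next
      case (step k)
      have "(?X u k, ?X u (Suc k)) \<in> ?E n u" using step by (auto simp: path_edges_def)
      then have "(?X u k, ?X u (Suc k)) \<in> ?O"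
        using u path_edges_subset[of a b c T n u] by (auto simp: U_def parcs_open_digraph)
      with step show ?case by (auto intro: rtrancl_into_rtrancl)
    qed
    have sub: "F \<subseteq> parcs (oriented_cluster \<omega> v)"
    proof
      fix e assume "e \<in> F"
      then obtain u where u: "u \<in> U n" "e \<in> ?E n u" by (auto simp: F_def)
      then have "e \<in> ?O"
        using path_edges_subset[of a b c T n u] by (auto simp: U_def parcs_open_digraph)
      moreover have "(v, fst e) \<in> ?O\<^sup>*" using u reach[of u] by (auto simp: path_edges_def)
      ultimately show "e \<in> parcs (oriented_cluster \<omega> v)" by (simp add: parcs_oriented_cluster)
    qed
    have energy: "(\<Sum>e\<in>F. (\<theta> e)\<^sup>2) \<le> K"
      using K by (simp add: \<theta>_def power_mult_distrib sum_distrib_left[symmetric] mult(2))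
    have drop: "(\<Sum>e\<in>?E n u. h (fst e) - h (snd e)) = h v" if "u \<in> U n" for u
    proof -
      have "(\<Sum>e\<in>?E n u. h (fst e) - h (snd e)) = (\<Sum>k\<in>{T..<n}. h (?X u k) - h (?X u (Suc k)))"
        unfolding path_edges_def by (subst sum.reindex[OF inj_on_path_edge]) simp
      also have "\<dots> = h (?X u T) - h (?X u n)"
        using sum_Suc_diff'[OF Tn, of "\<lambda>k. - h (?X u k)"] by (simp add: algebra_simps)
      also have "h (?X u n) = 0" using l[of "?X u n"] ln by (auto simp: level_path_pos)
      finally show ?thesis using that by (simp add: U_def)
    qed
    have "(\<Sum>(y, z)\<in>F. \<theta> (y, z) * (h y - h z)) = \<beta> n * (\<Sum>e\<in>F. card {u\<in>U n. e \<in> ?E n u} * (h (fst e) - h (snd e)))"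
      by (simp add: \<theta>_def case_prod_beta sum_distrib_left mult.assoc)
    also have "\<dots> = \<beta> n * card (U n) * h v"
      unfolding mult(1) using drop by simp
    finally have flow: "(\<Sum>(y, z)\<in>F. \<theta> (y, z) * (h y - h z)) = \<beta> n * card (U n) * h v" .
    show ?thesis
    proof (cases "0 \<le> h v")
      case True
      then have "r * h v \<le> \<beta> n * card (U n) * h v" using r by (intro mult_right_mono)
      then show ?thesis
        using sub energy flow finU finite_path_edges
        by (intro exI[of _ F] exI[of _ \<theta>]) (auto simp: F_def)
    next
      case False
      \<comment> \<open>For negative \<open>h v\<close> the empty flow suffices. It needs
        \<open>0 \<le> K\<close>, which the energy of the flow found above supplies.\<close>
      have "0 \<le> K" using energy by (meson sum_nonneg zero_le_power2 order_trans)
      with False \<open>0 < r\<close> show ?thesis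
        by (intro exI[of _ "{}"] exI) (auto simp: mult_nonneg_nonpos)
    qed
  qed
qed

section \<open>From moments to almost sure transience\<close>

lemma summable_unpredictability: "summable (\<lambda>k. (128 / real k) powr (4 / 3))"
proof -
  \<comment> \<open>At \<open>k = 0\<close> both forms of the term are 0 by convention.\<close>
  have "summable (\<lambda>k. 128 powr (4 / 3) * real k powr - (4 / 3))"
    by (intro summable_mult) (simp add: summable_real_powr_iff)
  then show ?thesis by (simp add: powr_divide powr_minus field_simps)
qed

text \<open>Freezing \<open>u\<close> turns it into the fixed path of the meeting bound, which is
  then averaged over \<open>u'\<close>; the resulting factor is the same for every
  \<open>u\<close>.\<close>

lemma path_edges_moment:
  fixes a b c :: "'d::finite"
  assumes abc: "a \<noteq> b" "a \<noteq> c" "b \<noteq> c"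
    and s: "0 \<le> s" "s * (\<Sum>k. (128 / real k) powr (4 / 3)) \<le> 1 / 2"
  shows "(\<Sum>u\<in>path_params n. \<Sum>u'\<in>path_params n.
      (1 + s) ^ card (path_edges a b c T n u \<inter> path_edges a b c T n u'))
    \<le> (real (card (path_params n)))\<^sup>2 * (1 + 2 * s * (\<Sum>k\<in>{T<..n}. (128 / real k) powr (4 / 3)))"
proof -
  let ?X = "path_pos a b c" and ?c = "real (card (path_params n))"
  let ?R = "1 + 2 * s * (\<Sum>k\<in>{T<..n}. (128 / real k) powr (4 / 3))"
  have "(\<Sum>u'\<in>path_params n. (1 + s) ^ card (path_edges a b c T n u \<inter> path_edges a b c T n u')) \<le> ?c * ?R" for u
  proof -
    have "(\<Sum>u'\<in>path_params n. (1 + s) ^ card (path_edges a b c T n u \<inter> path_edges a b c T n u'))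
        \<le> (\<Sum>u'\<in>path_params n. (1 + s) ^ card {k\<in>{T<..n}. ?X u' k = ?X u k})"
      by (intro sum_mono power_increasing)
        (use s card_path_edges_Int_le[of a b c T n _ u] in \<open>auto simp: Int_commute\<close>)
    also have "\<dots> \<le> ?c * ?R"
    proof (rule unpredictable_meetings_moment[OF _ summable_unpredictability s])
      fix j k y and g :: "(nat \<times> nat \<Rightarrow> nat \<times> nat) \<Rightarrow> real"
      assume "j < k" "k \<le> n" "\<And>u. 0 \<le> g u"
        "\<And>u u'. \<lbrakk>u \<in> path_params n; u' \<in> path_params n; \<forall>i\<le>j. ?X u i = ?X u' i\<rbrakk> \<Longrightarrow> g u = g u'"
      from path_pos_unpredictable[OF abc this]
      show "(\<Sum>u\<in>path_params n. of_bool (?X u k = y) * g u)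
          \<le> (128 / real (k - j)) powr (4 / 3) * (\<Sum>u\<in>path_params n. g u)" .
    qed simp
    finally show ?thesis .
  qed
  then have "(\<Sum>u\<in>path_params n. \<Sum>u'\<in>path_params n.
      (1 + s) ^ card (path_edges a b c T n u \<inter> path_edges a b c T n u')) \<le> (\<Sum>u\<in>path_params n. ?c * ?R)"
    by (rule sum_mono)
  then show ?thesis by (simp add: power2_eq_square mult.assoc)
qed

lemma finite_bounded_int_vectors: "finite {x :: int ^ 'd::finite. \<forall>i. 0 \<le> x $ i \<and> x $ i \<le> m}"
proof (rule finite_subset)
  show "{x :: int ^ 'd. \<forall>i. 0 \<le> x $ i \<and> x $ i \<le> m} \<subseteq> vec_lambda ` (\<Pi>\<^sub>E i\<in>UNIV. {0..m})"
    by (auto intro!: image_eqI[of _ _ "vec_nth _"] simp: PiE_iff)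
qed (auto intro!: finite_PiE)

text \<open>The condition on \<open>p\<close> is free of \<open>\<epsilon>\<close>, which only
  decides how large the starting level \<open>T\<close> has to be.\<close>

lemma oriented_percolation_transient_prob:
  fixes a b c :: "'d::finite"
  assumes abc: "a \<noteq> b" "a \<noteq> c" "b \<noteq> c" and p: "0 < p" "p < 1"
    and small: "((1 / p)\<^sup>2 - 1) * (\<Sum>k. (128 / real k) powr (4 / 3)) \<le> 1 / 2" and "0 < \<epsilon>"
  shows "\<exists>L\<in>sets (oriented_percolation p). 1 - \<epsilon> \<le> measure (oriented_percolation p) L \<and>
    (\<forall>\<omega>\<in>L. \<exists>v :: int ^ 'd. transient_graph (oriented_cluster \<omega> v))"
proof -
  let ?M = "oriented_percolation p :: ((int ^ 'd) \<times> (int ^ 'd) \<Rightarrow> bool) measure"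
  let ?X = "path_pos a b c :: _ \<Rightarrow> _ \<Rightarrow> int ^ 'd"
  define x where "x = 1 / p"
  define s where "s = x\<^sup>2 - 1"
  have x: "1 < x" using p by (simp add: x_def)
  then have s: "0 < s" by (simp add: s_def one_less_power)
  have sA: "s * (\<Sum>k. (128 / real k) powr (4 / 3)) \<le> 1 / 2" using small by (simp add: s_def x_def)
  interpret prob_space ?M
    unfolding oriented_percolation_def by (intro prob_space_PiM prob_space_measure_pmf)
  define \<delta> where "\<delta> = min 1 (\<epsilon> / 8)"
  have \<delta>: "0 < \<delta>" "\<delta> \<le> 1" "8 * \<delta> \<le> \<epsilon>" using \<open>0 < \<epsilon>\<close> by (auto simp: \<delta>_def)
  have "0 < \<delta> / (2 * s)" using \<delta> s by simp
  then obtain T where T: "\<And>m n. T \<le> m \<Longrightarrow> norm (\<Sum>k\<in>{m..<n}. (128 / real k) powr (4 / 3)) < \<delta> / (2 * s)"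
    using summable_unpredictability[unfolded summable_Cauchy] by blast
  have tail: "2 * s * (\<Sum>k\<in>{T<..n}. (128 / real k) powr (4 / 3)) \<le> \<delta>" for n
  proof -
    have "{T<..n} = {Suc T..<Suc n}" by auto
    then have "(\<Sum>k\<in>{T<..n}. (128 / real k) powr (4 / 3)) < \<delta> / (2 * s)"
      using T[of "Suc T" "Suc n"] by simp
    then show ?thesis using s by (simp add: field_simps)
  qed
  let ?E = "path_edges a b c T"
  define A where "A n u = {\<omega>\<in>space ?M. \<forall>e\<in>?E n u. \<omega> e}" for n u
  define N where "N n u u' = card (?E n u \<inter> ?E n u')" for n u u'
  define q where "q n = p ^ (n - T)" for n
  \<comment> \<open>With this weight the total strength of all open paths is their normalised
    number, which has mean 1.\<close>
  define \<beta> where "\<beta> n = 1 / (card (path_params n) * q n)" for n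
  define K where "K = 4 / ((x - 1) * \<epsilon>)"
  define G where "G n = {\<omega>\<in>space ?M. 1 / 2 \<le> (\<Sum>u\<in>path_params n. indicator (A n u) \<omega>) / (card (path_params n) * q n) \<and>
      (\<Sum>u\<in>path_params n. \<Sum>u'\<in>path_params n. real (N n u u') * indicator (A n u \<inter> A n u') \<omega>) / (card (path_params n) * q n)\<^sup>2 \<le> K}" for n
  have q: "0 < q n" for n using p by (simp add: q_def)
  have A: "A n u \<in> events" "prob (A n u) = q n" for n u
    unfolding A_def q_def
    using oriented_percolation_all_open[OF finite_path_edges path_edges_subset, of p a b c T n u] p
    by (simp_all add: card_path_edges)
  \<comment> \<open>A shared edge has to be open once instead of twice, which gains a factor
    \<open>1 / p = x\<close> for each of them.\<close>
  have AA: "prob (A n u \<inter> A n u') = (q n)\<^sup>2 * x ^ N n u u'" for n u u'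
  proof -
    have "A n u \<inter> A n u' = {\<omega>\<in>space ?M. \<forall>e\<in>?E n u \<union> ?E n u'. \<omega> e}" by (auto simp: A_def)
    then have "prob (A n u \<inter> A n u') = p ^ card (?E n u \<union> ?E n u')"
      using oriented_percolation_all_open(2)[of "?E n u \<union> ?E n u'" p] p
      by (simp add: finite_path_edges path_edges_subset)
    moreover have "(n - T) + (n - T) = card (?E n u \<union> ?E n u') + N n u u'"
      using card_Un_Int[OF finite_path_edges finite_path_edges, of a b c T n u a b c T n u']
      by (simp add: N_def card_path_edges)
    then have "(q n)\<^sup>2 = p ^ card (?E n u \<union> ?E n u') * p ^ N n u u'"
      unfolding q_def power2_eq_square power_add[symmetric] by simp
    ultimately show ?thesis using p by (simp add: x_def power_one_over)
  qed
  have moment: "(\<Sum>u\<in>path_params n. \<Sum>u'\<in>path_params n. (x\<^sup>2) ^ N n u u')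
      \<le> (real (card (path_params n)))\<^sup>2 * (1 + \<delta>)" for n
  proof -
    have "(\<Sum>u\<in>path_params n. \<Sum>u'\<in>path_params n. (x\<^sup>2) ^ N n u u')
      \<le> (real (card (path_params n)))\<^sup>2 * (1 + 2 * s * (\<Sum>k\<in>{T<..n}. (128 / real k) powr (4 / 3)))"
      using path_edges_moment[OF abc _ sA, where n=n and T=T] s by (simp add: s_def N_def)
    also have "\<dots> \<le> (real (card (path_params n)))\<^sup>2 * (1 + \<delta>)"
      using tail[of n] by (intro mult_left_mono) auto
    finally show ?thesis .
  qed
  have good: "G n \<in> events" "1 - \<epsilon> \<le> prob (G n)" for n
    using second_moment_events[where \<Omega>="path_params n" and A="A n" and N="N n", OF finite_path_params
        path_params_nonempty A(1) q x A(2) AA moment \<open>0 < \<epsilon>\<close> \<delta>(3,2)]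
    by (simp_all only: G_def K_def)
  define L where "L = (\<Inter>m. \<Union>n\<in>{m..}. G n)"
  have L: "L \<in> events"
    unfolding L_def by (rule prob_infinitely_often_ge(1)[where ?n0.0=0 and r="1 - \<epsilon>"]; rule good)
  have L_prob: "1 - \<epsilon> \<le> prob L"
    unfolding L_def by (rule prob_infinitely_often_ge(2)[where ?n0.0=0]; rule good)
  have "\<exists>v :: int ^ 'd. transient_graph (oriented_cluster \<omega> v)" if \<omega>: "\<omega> \<in> L" for \<omega>
  proof -
    \<comment> \<open>A finite box that holds every possible position at time \<open>T\<close>. A
      total strength of at least 1/2 leaves at least \<open>r\<close> to one of its
      vertices.\<close>
    define V where "V = {x :: int ^ 'd. \<forall>i. 0 \<le> x $ i \<and> x $ i \<le> int T}"
    have finV: "finite V" unfolding V_def by (rule finite_bounded_int_vectors)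
    have "0 \<in> V" by (simp add: V_def)
    with finV have V: "0 < card V" by (auto simp: card_gt_0_iff)
    define r where "r = 1 / (2 * card V)"
    define U where "U v n = {u \<in> path_params n. ?X u T = v \<and> (\<forall>e\<in>?E n u. \<omega> e)}" for v n
    have finU: "finite (U v n)" for v n by (simp add: U_def finite_path_params)
    have inV: "?X u T \<in> V" for u
    proof -
      have "card {m\<in>{1..T}. step_dir a b c u m = i} \<le> T" for i
      proof -
        have "card {m\<in>{1..T}. step_dir a b c u m = i} \<le> card {1..T}" by (intro card_mono) auto
        then show ?thesis by simp
      qed
      then show ?thesis by (simp add: V_def path_pos_component)
    qed
    have \<beta>: "0 \<le> \<beta> n" for n using q[of n] by (simp add: \<beta>_def)
    have G: "\<exists>v\<in>V. r \<le> \<beta> n * card (U v n) \<and>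
        (\<beta> n)\<^sup>2 * (\<Sum>u\<in>U v n. \<Sum>u'\<in>U v n. card (?E n u \<inter> ?E n u')) \<le> K" if g: "\<omega> \<in> G n" for n
    proof -
      have sp: "\<omega> \<in> space ?M" using g by (simp add: G_def)
      have in_A: "\<omega> \<in> A n u \<longleftrightarrow> (\<forall>e\<in>?E n u. \<omega> e)" for u using sp by (simp add: A_def)
      let ?W = "{u\<in>path_params n. \<omega> \<in> A n u}"
      have "(\<Sum>u\<in>path_params n. indicator (A n u) \<omega> :: real) = card ?W"
        by (simp add: indicator_def finite_path_params sum.If_cases Int_def)
      moreover have "?W = (\<Union>v\<in>V. U v n)" using inV by (auto simp: U_def in_A)
      moreover have "card (\<Union>v\<in>V. U v n) = (\<Sum>v\<in>V. card (U v n))"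
        by (rule card_UN_disjoint[OF finV]) (auto simp: finU, auto simp: U_def)
      ultimately have "(\<Sum>v\<in>V. \<beta> n * card (U v n)) = \<beta> n * (\<Sum>u\<in>path_params n. indicator (A n u) \<omega>)"
        by (simp only: sum_distrib_left[symmetric] of_nat_sum)
      then have half: "1 / 2 \<le> (\<Sum>v\<in>V. \<beta> n * card (U v n))"
        using g by (simp only: G_def \<beta>_def mem_Collect_eq) simp
      have "\<exists>v\<in>V. r \<le> \<beta> n * card (U v n)"
      proof (rule ccontr)
        assume "\<not> ?thesis"
        then have "(\<Sum>v\<in>V. \<beta> n * card (U v n)) < (\<Sum>v\<in>V. r)"
          using finV \<open>0 \<in> V\<close> by (intro sum_strict_mono) auto
        also have "\<dots> = 1 / 2" using V by (simp add: r_def)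
        finally show False using half by simp
      qed
      then obtain v where v: "v \<in> V" "r \<le> \<beta> n * card (U v n)" by blast
      have ind: "indicator (A n u \<inter> A n u') \<omega> = (1 :: real)"
        if "u \<in> U v n" "u' \<in> U v n" for u u'
        using that by (auto simp: U_def in_A)
      have "(\<Sum>u\<in>U v n. \<Sum>u'\<in>U v n. real (N n u u'))
          = (\<Sum>u\<in>U v n. \<Sum>u'\<in>U v n. real (N n u u') * indicator (A n u \<inter> A n u') \<omega>)"
        by (intro sum.cong refl) (simp add: ind)
      also have "\<dots> \<le> (\<Sum>u\<in>U v n. \<Sum>u'\<in>path_params n. real (N n u u') * indicator (A n u \<inter> A n u') \<omega>)"
        by (intro sum_mono sum_mono2 finite_path_params) (auto simp: U_def)
      also have "\<dots> \<le> (\<Sum>u\<in>path_params n. \<Sum>u'\<in>path_params n. real (N n u u') * indicator (A n u \<inter> A n u') \<omega>)"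
        by (intro sum_mono2 finite_path_params sum_nonneg) (auto simp: U_def)
      finally have "(\<beta> n)\<^sup>2 * (\<Sum>u\<in>U v n. \<Sum>u'\<in>U v n. real (N n u u'))
          \<le> (\<beta> n)\<^sup>2 * (\<Sum>u\<in>path_params n. \<Sum>u'\<in>path_params n. real (N n u u') * indicator (A n u \<inter> A n u') \<omega>)"
        by (intro mult_left_mono) auto
      also have "\<dots> \<le> K" using g by (simp add: G_def \<beta>_def power_divide)
      finally show ?thesis using v by (auto simp: N_def)
    qed
    have "\<exists>\<^sub>F n in sequentially. \<exists>v\<in>V. r \<le> \<beta> n * card (U v n) \<and>
        (\<beta> n)\<^sup>2 * (\<Sum>u\<in>U v n. \<Sum>u'\<in>U v n. card (?E n u \<inter> ?E n u')) \<le> K"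
      unfolding frequently_sequentially
    proof
      fix m
      obtain n where "m \<le> n" "\<omega> \<in> G n" using \<omega> by (auto simp: L_def)
      with G show "\<exists>n\<ge>m. \<exists>v\<in>V. r \<le> \<beta> n * card (U v n) \<and>
          (\<beta> n)\<^sup>2 * (\<Sum>u\<in>U v n. \<Sum>u'\<in>U v n. card (?E n u \<inter> ?E n u')) \<le> K" by blast
    qed
    \<comment> \<open>The vertex found for \<open>\<omega> \<in> G n\<close> may change with
      \<open>n\<close>; one of the finitely many candidates serves infinitely many
      \<open>n\<close>.\<close>
    from frequently_bex_finite[OF finV this] obtain v where
      "\<exists>\<^sub>F n in sequentially. r \<le> \<beta> n * card (U v n) \<and>
        (\<beta> n)\<^sup>2 * (\<Sum>u\<in>U v n. \<Sum>u'\<in>U v n. card (?E n u \<inter> ?E n u')) \<le> K" by blast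
    moreover have "0 < r" using V by (simp add: r_def)
    ultimately have "transient_graph (oriented_cluster \<omega> v)"
      unfolding U_def by (intro transient_oriented_cluster_if_paths[OF _ \<beta>])
    then show ?thesis ..
  qed
  with L L_prob show ?thesis by blast
qed

theorem mainTheorem4:
  assumes "CARD('d::finite) \<ge> 3"
  shows "\<exists>p0<1. \<forall>p\<in>{0<..<1}. p0 < p \<longrightarrow>
    (AE \<omega> in oriented_percolation p. \<exists>v :: int ^ 'd. transient_graph (oriented_cluster \<omega> v))"
proof -
  obtain a b c :: 'd where abc: "a \<noteq> b" "a \<noteq> c" "b \<noteq> c"
  proof -
    obtain D :: "'d set" where "card D = 3" using obtain_subset_with_card_n[OF assms] by blast
    then show ?thesis using that by (auto simp: card_3_iff)
  qed
  define S where "S = (\<Sum>k. (128 / real k) powr (4 / 3))"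
  have S: "0 \<le> S" unfolding S_def by (intro suminf_nonneg summable_unpredictability) simp
  \<comment> \<open>For positive \<open>p\<close>, \<open>p0 < p\<close> means
    \<open>(1 / p)\<^sup>2 < 1 + t\<close>, and \<open>t\<close> is chosen so that this margin times
    \<open>S\<close> is at most 1/2. Neither \<open>S\<close> nor \<open>p0\<close> depends on the
    dimension.\<close>
  define t where "t = 1 / (2 * (S + 1))"
  have t: "0 < t" "t * S \<le> 1 / 2" using S by (auto simp: t_def field_simps)
  define p0 where "p0 = 1 / sqrt (1 + t)"
  have "p0 < 1" using t by (simp add: p0_def)
  moreover have "AE \<omega> in oriented_percolation p. \<exists>v :: int ^ 'd. transient_graph (oriented_cluster \<omega> v)"
    if p: "0 < p" "p < 1" "p0 < p" for p
  proof -
    let ?M = "oriented_percolation p :: ((int ^ 'd) \<times> (int ^ 'd) \<Rightarrow> bool) measure"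
    interpret prob_space ?M
      unfolding oriented_percolation_def by (intro prob_space_PiM prob_space_measure_pmf)
    have "1 / p < sqrt (1 + t)" using p t by (simp add: p0_def field_simps)
    then have "(1 / p)\<^sup>2 < (sqrt (1 + t))\<^sup>2" using p by (intro power_strict_mono) auto
    then have "(1 / p)\<^sup>2 - 1 \<le> t" using t by simp
    then have "((1 / p)\<^sup>2 - 1) * S \<le> 1 / 2" using S t(2) by (meson mult_right_mono order_trans)
    then have "\<exists>L\<in>events. 1 - 1 / real (Suc k) \<le> prob L \<and>
        (\<forall>\<omega>\<in>L. \<exists>v :: int ^ 'd. transient_graph (oriented_cluster \<omega> v))" for k
      using oriented_percolation_transient_prob[OF abc p(1,2)] by (simp add: S_def)
    then obtain L where L: "\<And>k. L k \<in> events" "\<And>k. 1 - 1 / real (Suc k) \<le> prob (L k)"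
      "\<And>k \<omega>. \<omega> \<in> L k \<Longrightarrow> \<exists>v :: int ^ 'd. transient_graph (oriented_cluster \<omega> v)"
      by metis
    \<comment> \<open>The transience event itself is not shown to be measurable; the measurable sets
      \<open>L k\<close> inside it have a union of probability 1.\<close>
    have "1 - 1 / real (Suc k) \<le> prob (\<Union>k. L k)" for k
      using L(2)[of k] finite_measure_mono[of "L k" "\<Union>k. L k"] L(1) by fastforce
    moreover have "(\<lambda>k. 1 - 1 / real (Suc k)) \<longlonglongrightarrow> 1 - 0"
      by (intro tendsto_intros LIMSEQ_inverse_real_of_nat[unfolded inverse_eq_divide])
    ultimately have "1 \<le> prob (\<Union>k. L k)"
      by (intro LIMSEQ_le_const2[where X="\<lambda>k. 1 - 1 / real (Suc k)"]) auto
    then have "prob (\<Union>k. L k) = 1" using prob_le_1 by (intro antisym)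
    then have "AE \<omega> in ?M. \<omega> \<in> (\<Union>k. L k)" by (rule AE_prob_1)
    then show ?thesis by (rule eventually_mono) (use L(3) in blast)
  qed
  ultimately show ?thesis by (intro exI[of _ p0]) auto
qed

end
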